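(* The lattice $\Delta_{1/2}\mathscr{PL}$ is both upper dense and lower dense in the lattice $\mathscr{PL}$. That is: (upper density) whenever $I\in\Delta_{1/2}\mathscr{PL}$, $J\in\mathscr{PL}$ and $I\subsetneq J$, there is $L\in\Delta_{1/2}\mathscr{PL}$ with $I\subsetneq L\subsetneq J$; and (lower density) whenever $I\in\Delta_{1/2}\mathscr{PL}$, $J\in\mathscr{PL}$ and $J\subsetneq I$, there is $L\in\Delta_{1/2}\mathscr{PL}$ with $J\subsetneq L\subsetneq I$.
   Context: $H$ is a separable infinite-dimensional complex Hilbert space. "Ideal" means a two-sided ideal of $B(H)$ contained in the compact operators $K(H)$. $c_o^*$ is the set of nonnegative monotone nonincreasing sequences converging to $0$. For a compact operator $X$, $s(X)\in c_o^*$ is its sequence of s-numbers (singular values, with multiplicity), and $\Sigma(I):=\{s(X)\mid X\in I\}$ is the characteristic set of the ideal $I$; $I\mapsto\Sigma(I)$ is an inclusion-preserving bijection between ideals and the hereditary (solid) subcones of $c_o^*$ invariant under all ampliations $D_m$, where $(D_m\xi)_n:=\xi_{\lceil n/m\rceil}$, $m\in\mathbb N$. For $\xi\in c_o^*$, $(\xi)$ denotes the principal ideal generated by the diagonal operator $\mathrm{diag}\,\xi$; every principal ideal has this form, and $\eta\in\Sigma((\xi))$ if and only if $\eta=O(D_m\xi)$ for some $m\in\mathbb N$. $\mathscr{PL}$ is the lattice (under inclusion, with meet $\cap$ and join $+$) of all nonzero principal ideals. A sequence $\xi\in c_o^*$ satisfies the $\Delta_{1/2}$-condition if $D_2\xi=O(\xi)$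 (equivalently, $\xi_n\le M\xi_{2n}$ for some $M>1$ and all $n$). $\Delta_{1/2}\mathscr{PL}$ is the sublattice of all nonzero principal ideals having a generator sequence that satisfies the $\Delta_{1/2}$-condition. *)

theory Defs
  imports "HOL-Analysis.Analysis"
begin

subsection \<open>Complex Hilbert spaces\<close>

class complex_vector = ab_group_add +
  fixes scaleC :: "complex \<Rightarrow> 'a \<Rightarrow> 'a"  (infixr \<open>*\<^sub>C\<close> 75)
  assumes scaleC_add_right: "a *\<^sub>C (x + y) = a *\<^sub>C x + a *\<^sub>C y"
    and scaleC_add_left: "(a + b) *\<^sub>C x = a *\<^sub>C x + b *\<^sub>C x"
    and scaleC_scaleC: "a *\<^sub>C (b *\<^sub>C x) = (a * b) *\<^sub>C x"
    and scaleC_one: "1 *\<^sub>C x = x"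

global_interpretation complex_vector:
  vector_space "scaleC :: complex \<Rightarrow> 'a \<Rightarrow> 'a::complex_vector"
  by unfold_locales (fact scaleC_add_right scaleC_add_left scaleC_scaleC scaleC_one)+

text \<open>
  The inner product is conjugate linear in its first and linear in its second argument, so the
  coefficient of \<open>x\<close> at a unit vector \<open>e\<close> is \<open>cinner e x\<close>. The real normed structure is the
  underlying one; through it convergence, completeness and compactness are those of the library.
\<close>

class complex_inner = complex_vector + real_normed_vector +
  fixes cinner :: "'a \<Rightarrow> 'a \<Rightarrow> complex"
  assumes scaleR_scaleC: "r *\<^sub>R x = complex_of_real r *\<^sub>C x"
    and cinner_commute: "cinner x y = cnj (cinner y x)"
    and cinner_add_right: "cinner x (y + z) = cinner x y + cinner x z"
    and cinner_scaleC_right: "cinner x (c *\<^sub>C y) = c * cinner x y"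
    and cinner_self_nonneg: "0 \<le> Re (cinner x x)"
    and cinner_self_eq_zero_iff: "cinner x x = 0 \<longleftrightarrow> x = 0"
    and norm_eq_sqrt_cinner: "norm x = sqrt (Re (cinner x x))"

class chilbert_space = complex_inner + complete_space

definition separable_hilbert :: "'a::chilbert_space itself \<Rightarrow> bool" where
  "separable_hilbert _ \<longleftrightarrow> (\<exists>D::'a set. countable D \<and> closure D = UNIV)"

definition infinite_dimensional :: "'a::chilbert_space itself \<Rightarrow> bool" where
  "infinite_dimensional _ \<longleftrightarrow> \<not> (\<exists>B::'a set. finite B \<and> complex_vector.span B = UNIV)"

definition orthonormal_basis :: "(nat \<Rightarrow> 'a::chilbert_space) \<Rightarrow> bool" where
  "orthonormal_basis e \<longleftrightarrow>
     (\<forall>i j. cinner (e i) (e j) = (if i = j then 1 else 0)) \<and>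
     closure (complex_vector.span (range e)) = UNIV"


subsection \<open>Operator ideals\<close>

definition bounded_op :: "('a::chilbert_space \<Rightarrow> 'a) \<Rightarrow> bool" where
  "bounded_op T \<longleftrightarrow> bounded_linear T \<and> (\<forall>c x. T (c *\<^sub>C x) = c *\<^sub>C T x)"

definition compact_op :: "('a::chilbert_space \<Rightarrow> 'a) \<Rightarrow> bool" where
  "compact_op T \<longleftrightarrow> bounded_op T \<and> compact (closure (T ` cball 0 1))"

text \<open>Closure under complex scalars is the case \<open>A = (\<lambda>x. c *\<^sub>C x)\<close>, \<open>B = id\<close> of the last clause.\<close>

definition operator_ideal :: "('a::chilbert_space \<Rightarrow> 'a) set \<Rightarrow> bool" where
  "operator_ideal I \<longleftrightarrow>
     (\<forall>T\<in>I. compact_op T) \<and>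
     (\<lambda>x. 0) \<in> I \<and>
     (\<forall>S\<in>I. \<forall>T\<in>I. (\<lambda>x. S x + T x) \<in> I) \<and>
     (\<forall>T\<in>I. \<forall>A B. bounded_op A \<longrightarrow> bounded_op B \<longrightarrow> A \<circ> T \<circ> B \<in> I)"

definition principal_ideal :: "('a::chilbert_space \<Rightarrow> 'a) \<Rightarrow> ('a \<Rightarrow> 'a) set" where
  "principal_ideal X = \<Inter>{I. operator_ideal I \<and> X \<in> I}"

definition PL :: "('a::chilbert_space \<Rightarrow> 'a) set set" where
  "PL = {principal_ideal X |X. compact_op X} - {{\<lambda>x. 0}}"


subsection \<open>Sequences and diagonal operators\<close>

definition c0_star :: "(nat \<Rightarrow> real) set" where
  "c0_star = {\<xi>. (\<forall>n. 0 \<le> \<xi> n) \<and> decseq \<xi> \<and> \<xi> \<longlonglongrightarrow> 0}"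

text \<open>
  Sequences are indexed from \<open>0\<close>: \<open>\<xi> k\<close> stands for the term with number \<open>k + 1\<close>. In this
  indexing \<open>\<lceil>n / m\<rceil>\<close>, for \<open>n = k + 1\<close>, becomes \<open>k div m\<close>.
\<close>

definition ampliation :: "nat \<Rightarrow> (nat \<Rightarrow> real) \<Rightarrow> nat \<Rightarrow> real" where
  "ampliation m \<xi> k = \<xi> (k div m)"

text \<open>
  The estimate \<open>D\<^sub>2 \<xi> = O(\<xi>)\<close> is required at all indices, not just eventually. The difference
  matters for finitely supported sequences: they satisfy the eventual version trivially, but of
  them only the zero sequence satisfies the condition below.
\<close>

definition Delta_half :: "(nat \<Rightarrow> real) \<Rightarrow> bool" where
  "Delta_half \<xi> \<longleftrightarrow> (\<exists>M. \<forall>k. ampliation 2 \<xi> k \<le> M * \<xi> k)"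

definition diag_op :: "(nat \<Rightarrow> 'a::chilbert_space) \<Rightarrow> (nat \<Rightarrow> real) \<Rightarrow> 'a \<Rightarrow> 'a" where
  "diag_op e \<xi> x = (\<Sum>n. (complex_of_real (\<xi> n) * cinner (e n) x) *\<^sub>C e n)"

text \<open>The parameter \<open>e\<close> is the orthonormal basis with respect to which operators are diagonal.\<close>

definition Delta_half_PL :: "(nat \<Rightarrow> 'a::chilbert_space) \<Rightarrow> ('a \<Rightarrow> 'a) set set" where
  "Delta_half_PL e =
     {I \<in> PL. \<exists>\<xi>\<in>c0_star. Delta_half \<xi> \<and> I = principal_ideal (diag_op e \<xi>)}"

end

theory Submission
  imports Defs
begin

text \<open>
  By Schmidt's decomposition every nonzero principal ideal is generated by a diagonal operator
  \<open>diag \<eta>\<close>, and comparing Gelfand numbers shows that \<open>(\<xi>) \<subseteq> (\<eta>)\<close> holds iff \<open>\<xi> = O(D\<^sub>m \<eta>)\<close> for some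
  \<open>m\<close>. The theorem thus becomes a statement about sequences.

  Let \<open>\<xi>\<close> satisfy the \<open>\<Delta>\<^bsub>1/2\<^esub>\<close>-condition. The sequences \<open>max \<xi> (min a (\<xi>\<^sup>2 / t))\<close> and
  \<open>min \<xi> (max a (\<xi>\<^sup>2 / t))\<close> satisfy it as well, with a constant that does not depend on \<open>a\<close> and \<open>t\<close>, and
  so do suprema and infima of such sequences. If \<open>\<xi> \<le> \<eta>\<close> and \<open>\<eta> \<noteq> O(\<xi>)\<close>, pick a sparse sequence of
  indices \<open>k\<^sub>j\<close> with \<open>\<eta>(k\<^sub>j) \<ge> j\<^sup>2 t\<^sub>j\<close>, where \<open>t\<^sub>j = \<xi>(k\<^sub>j)\<close>, and use the supremum over \<open>j\<close> of the former
  with \<open>a = j\<^sup>2 t\<^sub>j\<close>: it equals \<open>\<xi>\<close> at \<open>k\<^sub>j\<close> and is about \<open>j \<xi>(n)\<close> where \<open>\<xi>(n)\<close> is about \<open>j t\<^sub>j\<close>. If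
  \<open>\<eta> \<le> \<xi>\<close>, use in the same way the infimum of the latter with \<open>a = t\<^sub>j / j\<^sup>2\<close>, where
  \<open>\<xi>(k\<^sub>j) \<ge> j\<^sup>2 (D\<^sub>j \<eta>)(k\<^sub>j)\<close>.
\<close>

subsection \<open>Sequences with the doubling property\<close>

text \<open>Turns the failure of a bound at all indices into infinitely many bad indices. If
  \<open>a < r * b\<close> from some \<open>K\<close> on, then \<open>b K\<close> is positive, and
  before \<open>K\<close> monotonicity bounds the ratio of \<open>a\<close> to \<open>b\<close> by
  \<open>a 0 / b K\<close>, so one constant would serve everywhere.\<close>

lemma frequently_ge_of_not_bigo:
  fixes a b :: "nat \<Rightarrow> real"
  assumes "decseq a" "decseq b" "\<And>k. 0 < a k" "\<And>k. 0 \<le> b k"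
    and not_bigo: "\<nexists>C. \<forall>k. a k \<le> C * b k" and "0 \<le> r"
  shows "\<exists>\<^sub>F k in sequentially. r * b k \<le> a k"
proof (rule ccontr)
  assume "\<not> ?thesis"
  then obtain K where K: "\<And>k. k \<ge> K \<Longrightarrow> a k < r * b k"
    by (auto simp: not_frequently eventually_sequentially not_le)
  have "0 < r * b K" using K[of K] assms(3)[of K] by simp
  then have bK: "0 < b K" using \<open>0 \<le> r\<close> by (simp add: zero_less_mult_iff)
  have "a k \<le> max r (a 0 / b K) * b k" for k
  proof (cases "K \<le> k")
    case True
    then have "a k \<le> r * b k" using K by (simp add: less_imp_le)
    also have "\<dots> \<le> max r (a 0 / b K) * b k" using assms(4) by (intro mult_right_mono) auto
    finally show ?thesis .
  next
    case False
    then have "b K \<le> b k" using assms(2) by (simp add: decseqD)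
    have "a k \<le> a 0" using assms(1) by (simp add: decseqD)
    also have "\<dots> = a 0 / b K * b K" using bK by simp
    also have "\<dots> \<le> a 0 / b K * b k"
      using \<open>b K \<le> b k\<close> bK assms(3)[of 0] by (intro mult_left_mono) auto
    also have "\<dots> \<le> max r (a 0 / b K) * b k" using assms(4) by (intro mult_right_mono) auto
    finally show ?thesis .
  qed
  with not_bigo show False by blast
qed

text \<open>The index sought is the last one before the sequence first drops below \<open>v\<close>;
  a single step loses at most the factor \<open>M\<close>.\<close>

lemma exists_near_value:
  fixes \<xi> :: "nat \<Rightarrow> real"
  assumes "\<xi> \<longlonglongrightarrow> 0" "\<And>k. \<xi> k \<le> M * \<xi> (Suc k)" "0 \<le> M" "0 < v" "v \<le> \<xi> 0"
  obtains n where "v \<le> \<xi> n" "\<xi> n \<le> M * v"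
proof -
  obtain N where "\<xi> N < v"
    using order_tendstoD(2)[OF assms(1,4)] by (auto simp: eventually_sequentially)
  define p where "p = (LEAST n. \<xi> n < v)"
  have p: "\<xi> p < v" unfolding p_def by (rule LeastI) fact
  then obtain n where n: "p = Suc n" using assms(5) by (cases p) auto
  have "v \<le> \<xi> n" using not_less_Least[of n "\<lambda>n. \<xi> n < v"] n p_def by auto
  moreover have "\<xi> n \<le> M * v"
    using assms(2)[of n] mult_left_mono[of "\<xi> p" v M] p \<open>0 \<le> M\<close> n by auto
  ultimately show ?thesis by (rule that)
qed

text \<open>Normalizing \<open>1 \<le> M\<close> makes \<open>M\<^sup>2\<close> a common doubling
  constant for \<open>\<xi>\<close>, for \<open>\<xi>\<^sup>2 / t\<close> and for constants, so that
  it passes to their maxima and minima.\<close>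

locale doubling_sequence =
  fixes \<xi> :: "nat \<Rightarrow> real" and M :: real
  assumes c0: "\<xi> \<in> c0_star" and pos: "\<And>k. 0 < \<xi> k" and M_ge_1: "1 \<le> M"
    and doubling: "\<And>k. \<xi> (k div 2) \<le> M * \<xi> k"
begin

lemma dec: "decseq \<xi>" and tendsto_0: "\<xi> \<longlonglongrightarrow> 0"
  using c0 by (auto simp: c0_star_def)

text \<open>Follows from \<open>Suc k div 2 \<le> k\<close> and monotonicity.\<close>

lemma le_Suc: "\<xi> k \<le> M * \<xi> (Suc k)"
  using doubling[of "Suc k"] decseqD[OF dec, of "Suc k div 2" k] by linarith

lemma M_sq_ge_1: "1 \<le> M\<^sup>2"
  using M_ge_1 by (simp add: one_le_power)

lemma doubling_sq: "t > 0 \<Longrightarrow> (\<xi> (k div 2))\<^sup>2 / t \<le> M\<^sup>2 * ((\<xi> k)\<^sup>2 / t)"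
  using power_mono[OF doubling[of k], of 2] pos[of "k div 2"]
  by (simp add: power_mult_distrib divide_right_mono)

lemma doubling': "\<xi> (k div 2) \<le> M\<^sup>2 * \<xi> k"
proof -
  have "M * \<xi> k \<le> M\<^sup>2 * \<xi> k"
    using M_ge_1 pos[of k] by (intro mult_right_mono) (auto simp: power2_eq_square)
  with doubling[of k] show ?thesis by linarith
qed

lemma sq_le_M_sq_mult: "0 \<le> a \<Longrightarrow> a \<le> M\<^sup>2 * a"
  using mult_right_mono[OF M_sq_ge_1, of a] by simp

lemma sq_mono: "k \<le> n \<Longrightarrow> t > 0 \<Longrightarrow> (\<xi> n)\<^sup>2 / t \<le> (\<xi> k)\<^sup>2 / t"
  using decseqD[OF dec, of k n] pos[of n] by (intro divide_right_mono power_mono) auto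

lemma c0_star_between:
  assumes "decseq \<zeta>" "\<And>k. 0 \<le> \<zeta> k" "\<And>k. \<zeta> k \<le> \<eta> k" "\<eta> \<longlonglongrightarrow> 0"
  shows "\<zeta> \<in> c0_star"
  using assms tendsto_sandwich[of "\<lambda>_. 0" \<zeta> sequentially \<eta> 0] by (auto simp: c0_star_def)

section \<open>Construction of the intermediate sequences\<close>

lemma exists_sequence_above:
  assumes \<eta>: "\<eta> \<in> c0_star" and le: "\<And>k. \<xi> k \<le> \<eta> k" and not_bigo: "\<nexists>C. \<forall>k. \<eta> k \<le> C * \<xi> k"
  shows "\<exists>\<zeta>\<in>c0_star. Delta_half \<zeta> \<and> (\<forall>k. \<xi> k \<le> \<zeta> k) \<and> (\<forall>k. \<zeta> k \<le> \<eta> k) \<and>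
           (\<nexists>C. \<forall>k. \<zeta> k \<le> C * \<xi> k) \<and> (\<nexists>C. \<forall>k. \<eta> k \<le> C * \<zeta> k)"
proof -
  have eta_pos: "0 < \<eta> k" for k using le[of k] pos[of k] by linarith
  have eta: "decseq \<eta>" "\<eta> \<longlonglongrightarrow> 0" using \<eta> by (auto simp: c0_star_def)
  \<comment> \<open>The first clause makes \<open>\<eta>\<close> much larger than
    \<open>\<xi>\<close> at the new index. The second keeps the level
    \<open>real (Suc j) * \<xi> n\<close> within reach of \<open>exists_near_value\<close>. The
    third goes so far out that the new bump, whose cap is at most \<open>\<eta> n\<close>, does not
    rise above \<open>\<xi>\<close> at the earlier indices.\<close>
  define P where "P f j n \<longleftrightarrow> real (Suc j)^2 * \<xi> n \<le> \<eta> n \<and> real (Suc j) * \<xi> n \<le> \<xi> 0 \<and>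
      (\<forall>i<j. f i < n \<and> \<eta> n \<le> \<xi> (f i))" for f :: "nat \<Rightarrow> nat" and j n
  have "\<exists>f. \<forall>j. P f j (f j)"
  proof (rule dependent_wellorder_choice)
    show "P f x r = P g x r" if "\<And>y. y < x \<Longrightarrow> f y = g y" for r f g x
      using that by (auto simp: P_def)
  next
    fix j :: nat and f :: "nat \<Rightarrow> nat"
    have 1: "\<exists>\<^sub>F n in sequentially. real (Suc j)^2 * \<xi> n \<le> \<eta> n"
      using frequently_ge_of_not_bigo[OF eta(1) dec eta_pos less_imp_le[OF pos] not_bigo] by simp
    have 2: "\<forall>\<^sub>F n in sequentially. real (Suc j) * \<xi> n \<le> \<xi> 0"
      using order_tendstoD(2)[OF tendsto_mult_right_zero[where c = "real (Suc j)", OF tendsto_0] pos[of 0]]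
      by (rule eventually_mono) linarith
    have 3: "\<forall>\<^sub>F n in sequentially. \<forall>i\<in>{..<j}. f i < n \<and> \<eta> n \<le> \<xi> (f i)"
    proof (rule eventually_ball_finite, simp, intro ballI eventually_conj)
      show "\<forall>\<^sub>F n in sequentially. f i < n" for i by (rule eventually_gt_at_top)
      show "\<forall>\<^sub>F n in sequentially. \<eta> n \<le> \<xi> (f i)" for i
        using order_tendstoD(2)[OF eta(2) pos[of "f i"]] by (rule eventually_mono) simp
    qed
    \<comment> \<open>The first clause holds infinitely often and the others hold eventually, so
      some index satisfies them all.\<close>
    have "\<exists>\<^sub>F n in sequentially. P f j n"
      using frequently_eventually_conj[OF 1 eventually_conj[OF 2 3]]
      by (rule frequently_elim1) (auto simp: P_def)
    then show "\<exists>r. P f j r" by (rule frequently_ex)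
  qed
  then obtain f where f: "\<And>j. P f j (f j)" by blast
  define t where "t j = \<xi> (f j)" for j
  have t_pos: "0 < t j" for j by (simp add: t_def pos)
  have f1: "real (Suc j)^2 * t j \<le> \<eta> (f j)" and f2: "real (Suc j) * t j \<le> \<xi> 0" for j
    using f[of j] by (auto simp: P_def t_def)
  have f3: "f i < f j" "\<eta> (f j) \<le> t i" if "i < j" for i j
    using f[of j] that by (auto simp: P_def t_def)
  define h where "h j k = max (\<xi> k) (min (real (Suc j)^2 * t j) ((\<xi> k)\<^sup>2 / t j))" for j k
  have h_ge: "\<xi> k \<le> h j k" for j k by (simp add: h_def)
  have h_below: "h j k = \<xi> k" if "f j \<le> k" for j k
  proof -
    have "\<xi> k \<le> t j" using that dec by (simp add: t_def decseqD)
    then have "(\<xi> k)\<^sup>2 / t j \<le> \<xi> k"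
      using pos[of k] t_pos[of j] by (simp add: field_simps power2_eq_square)
    then show ?thesis by (simp add: h_def)
  qed
  have h_le: "h j k \<le> \<eta> k" for j k
  proof (cases "f j \<le> k")
    case False
    \<comment> \<open>Before \<open>f j\<close> the cap of the bump is at most
      \<open>\<eta> (f j)\<close>, hence at most \<open>\<eta> k\<close>.\<close>
    then have "\<eta> (f j) \<le> \<eta> k" using eta(1) by (simp add: decseqD)
    then show ?thesis using f1[of j] le[of k] by (auto simp: h_def min_le_iff_disj)
  qed (simp add: h_below le)
  have h_dec: "h j n \<le> h j k" if "k \<le> n" for j k n
    unfolding h_def by (intro max.mono min.mono order_refl sq_mono t_pos decseqD[OF dec] that)
  have h_dbl: "h j (k div 2) \<le> M\<^sup>2 * h j k" for j k
  proof -
    let ?a = "real (Suc j)^2 * t j" and ?b = "(\<xi> k)\<^sup>2 / t j"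
    have "h j (k div 2) \<le> max (M\<^sup>2 * \<xi> k) (min (M\<^sup>2 * ?a) (M\<^sup>2 * ?b))"
      unfolding h_def
      by (intro max.mono min.mono doubling' doubling_sq sq_le_M_sq_mult t_pos)
        (simp add: t_pos less_imp_le)
    also have "\<dots> = M\<^sup>2 * h j k"
      unfolding h_def by (simp add: max_mult_distrib_left min_mult_distrib_left)
    finally show ?thesis .
  qed
  define \<zeta> where "\<zeta> k = (SUP j. h j k)" for k
  \<comment> \<open>The bound \<open>\<eta> k\<close> makes the real-valued \<open>SUP\<close> a
    genuine least upper bound.\<close>
  have bdd: "bdd_above (range (\<lambda>j. h j k))" for k using h_le by (auto simp: bdd_above_def)
  have h_zeta: "h j k \<le> \<zeta> k" for j k unfolding \<zeta>_def by (rule cSUP_upper[OF _ bdd]) simp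
  have zeta_le: "\<zeta> k \<le> c" if "\<And>j. h j k \<le> c" for k c
    unfolding \<zeta>_def using that by (intro cSUP_least) auto
  have ge: "\<xi> k \<le> \<zeta> k" for k using h_ge[of k 0] h_zeta[of 0 k] by linarith
  have le': "\<zeta> k \<le> \<eta> k" for k by (rule zeta_le) (rule h_le)
  have "\<zeta> \<in> c0_star"
  proof (rule c0_star_between[OF _ _ le' eta(2)])
    show "decseq \<zeta>"
      unfolding decseq_def by (intro allI impI zeta_le) (meson h_dec h_zeta order_trans)
    show "0 \<le> \<zeta> k" for k using ge[of k] pos[of k] by linarith
  qed
  moreover have "Delta_half \<zeta>"
    unfolding Delta_half_def ampliation_def
  proof (intro exI allI zeta_le)
    fix k j
    have "h j (k div 2) \<le> M\<^sup>2 * h j k" by (rule h_dbl)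
    also have "\<dots> \<le> M\<^sup>2 * \<zeta> k" by (intro mult_left_mono h_zeta) simp
    finally show "h j (k div 2) \<le> M\<^sup>2 * \<zeta> k" .
  qed
  moreover have "\<nexists>C. \<forall>k. \<zeta> k \<le> C * \<xi> k"
  proof
    assume "\<exists>C. \<forall>k. \<zeta> k \<le> C * \<xi> k"
    then obtain C where C: "\<And>k. \<zeta> k \<le> C * \<xi> k" by blast
    obtain j where j: "C * M < real j" using reals_Archimedean2 by blast
    \<comment> \<open>At a point where \<open>\<xi> n\<close> is close to
      \<open>real (Suc j) * t j\<close>, the cap and the quadratic term are both at least
      \<open>real (Suc j) * \<xi> n / M\<close>, so the ratio of \<open>\<zeta>\<close> to
      \<open>\<xi>\<close> is unbounded.\<close>
    obtain n where n: "real (Suc j) * t j \<le> \<xi> n" "\<xi> n \<le> M * (real (Suc j) * t j)"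
      using exists_near_value[of \<xi> M "real (Suc j) * t j", OF tendsto_0 le_Suc _ _ f2[of j]] M_ge_1 t_pos[of j] by auto
    have "real (Suc j) * \<xi> n / M \<le> real (Suc j)^2 * t j"
      using mult_left_mono[OF n(2), of "real (Suc j)"] M_ge_1
      by (simp add: divide_le_eq power2_eq_square mult_ac)
    moreover have "real (Suc j) * \<xi> n / M \<le> (\<xi> n)\<^sup>2 / t j"
    proof -
      have "real (Suc j) * \<xi> n / M \<le> real (Suc j) * \<xi> n"
        using mult_left_mono[OF M_ge_1, of "real (Suc j) * \<xi> n"] M_ge_1 pos[of n]
        by (simp add: divide_le_eq)
      also have "\<dots> \<le> (\<xi> n)\<^sup>2 / t j"
        using mult_right_mono[OF n(1), of "\<xi> n"] pos[of n] t_pos[of j]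
        by (simp add: le_divide_eq power2_eq_square mult_ac)
      finally show ?thesis .
    qed
    ultimately have "real (Suc j) * \<xi> n / M \<le> h j n" by (simp add: h_def)
    also have "\<dots> \<le> C * \<xi> n" using C[of n] h_zeta[of j n] by linarith
    finally have "real (Suc j) * \<xi> n \<le> (C * M) * \<xi> n"
      using M_ge_1 by (simp add: divide_le_eq mult_ac)
    then show False using j pos[of n] by auto
  qed
  moreover have "\<nexists>C. \<forall>k. \<eta> k \<le> C * \<zeta> k"
  proof
    assume "\<exists>C. \<forall>k. \<eta> k \<le> C * \<zeta> k"
    then obtain C where C: "\<And>k. \<eta> k \<le> C * \<zeta> k" by blast
    obtain j where j: "C < real j" using reals_Archimedean2 by blast
    \<comment> \<open>No bump is active at \<open>f j\<close>: for \<open>i > j\<close> the cap is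
      at most \<open>t j\<close>, and for \<open>i \<le> j\<close> the bump has ended.\<close>
    have "\<zeta> (f j) \<le> \<xi> (f j)"
    proof (rule zeta_le)
      fix i
      show "h i (f j) \<le> \<xi> (f j)"
      proof (cases "j < i")
        case True
        then show ?thesis using f1[of i] f3[OF True] by (auto simp: h_def t_def min_le_iff_disj)
      next
        case False
        then have "f i \<le> f j" using f3(1)[of i j] by (cases "i = j") auto
        then show ?thesis by (simp add: h_below)
      qed
    qed
    then have z: "\<zeta> (f j) = t j" using ge[of "f j"] by (simp add: t_def)
    have "real (Suc j)^2 * t j \<le> C * t j" using order_trans[OF f1[of j] C[of "f j"]] by (simp only: z)
    then have "real (Suc j)^2 \<le> C" using t_pos[of j] by simp
    moreover have "real (Suc j) \<le> real (Suc j)^2" by (rule self_le_power) auto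
    ultimately show False using j by linarith
  qed
  ultimately show ?thesis using ge le' by blast
qed

text \<open>Growth is tested against every ampliation because \<open>\<eta>\<close> itself need not
  satisfy the doubling condition. Positivity of \<open>\<zeta>\<close> is recorded separately since
  \<open>\<eta>\<close> may have zeros.\<close>

lemma exists_sequence_below:
  assumes \<eta>: "\<eta> \<in> c0_star" and le: "\<And>k. \<eta> k \<le> \<xi> k"
    and not_bigo: "\<And>m. 0 < m \<Longrightarrow> \<nexists>C. \<forall>k. \<xi> k \<le> C * \<eta> (k div m)"
  shows "\<exists>\<zeta>\<in>c0_star. Delta_half \<zeta> \<and> (\<forall>k. 0 < \<zeta> k) \<and> (\<forall>k. \<eta> k \<le> \<zeta> k) \<and> (\<forall>k. \<zeta> k \<le> \<xi> k) \<and>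
           (\<forall>m>0. \<nexists>C. \<forall>k. \<zeta> k \<le> C * \<eta> (k div m)) \<and> (\<nexists>C. \<forall>k. \<xi> k \<le> C * \<zeta> k)"
proof -
  have eta: "decseq \<eta>" "\<And>k. 0 \<le> \<eta> k" using \<eta> by (auto simp: c0_star_def)
  \<comment> \<open>Stage \<open>j\<close> uses the ampliation by \<open>Suc j\<close>, so that
    every ampliation is eventually beaten. The second clause brings \<open>\<xi>\<close> at the new
    index down to the floor of each earlier dent, which is therefore over by then.\<close>
  define P where "P f j n \<longleftrightarrow> real (Suc j)^2 * \<eta> (n div Suc j) \<le> \<xi> n \<and>
      (\<forall>i<j. f i < n \<and> \<xi> n \<le> \<xi> (f i) / real (Suc i)^2)" for f :: "nat \<Rightarrow> nat" and j n
  have "\<exists>f. \<forall>j. P f j (f j)"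
  proof (rule dependent_wellorder_choice)
    show "P f x r = P g x r" if "\<And>y. y < x \<Longrightarrow> f y = g y" for r f g x
      using that by (auto simp: P_def)
  next
    fix j :: nat and f :: "nat \<Rightarrow> nat"
    have "decseq (\<lambda>n. \<eta> (n div Suc j))"
      using eta(1) by (simp add: decseq_def div_le_mono del: div_less)
    then have 1: "\<exists>\<^sub>F n in sequentially. real (Suc j)^2 * \<eta> (n div Suc j) \<le> \<xi> n"
      using frequently_ge_of_not_bigo[OF dec _ pos _ not_bigo[of "Suc j"]] eta(2) by simp
    have 2: "\<forall>\<^sub>F n in sequentially. \<forall>i\<in>{..<j}. f i < n \<and> \<xi> n \<le> \<xi> (f i) / real (Suc i)^2"
    proof (rule eventually_ball_finite, simp, intro ballI eventually_conj)
      show "\<forall>\<^sub>F n in sequentially. f i < n" for i by (rule eventually_gt_at_top)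
      show "\<forall>\<^sub>F n in sequentially. \<xi> n \<le> \<xi> (f i) / real (Suc i)^2" for i
        using order_tendstoD(2)[OF tendsto_0, of "\<xi> (f i) / real (Suc i)^2"] pos[of "f i"]
        by (auto elim!: eventually_mono)
    qed
    have "\<exists>\<^sub>F n in sequentially. P f j n"
      using frequently_eventually_conj[OF 1 2] by (rule frequently_elim1) (auto simp: P_def)
    then show "\<exists>r. P f j r" by (rule frequently_ex)
  qed
  then obtain f where f: "\<And>j. P f j (f j)" by blast
  define t where "t j = \<xi> (f j)" for j
  define s where "s j = t j / real (Suc j)^2" for j
  have t_pos: "0 < t j" for j by (simp add: t_def pos)
  have s_pos: "0 < s j" for j by (simp add: s_def t_pos)
  have f1: "real (Suc j)^2 * \<eta> (f j div Suc j) \<le> t j" for j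
    using f[of j] by (auto simp: P_def t_def)
  have f1': "\<eta> (f j div Suc j) \<le> s j" for j
    unfolding s_def using f1[of j] by (subst le_divide_eq) (simp add: mult.commute)
  have f3: "f i < f j" "t j \<le> s i" if "i < j" for i j
    using f[of j] that by (auto simp: P_def t_def s_def)
  define h where "h j k = min (\<xi> k) (max (s j) ((\<xi> k)\<^sup>2 / t j))" for j k
  have h_le: "h j k \<le> \<xi> k" for j k by (simp add: h_def)
  have h_above: "h j k = \<xi> k" if "k \<le> f j" for j k
  proof -
    have "t j \<le> \<xi> k" using that dec by (simp add: t_def decseqD)
    then have "\<xi> k \<le> (\<xi> k)\<^sup>2 / t j"
      using pos[of k] t_pos[of j] by (simp add: field_simps power2_eq_square)
    then show ?thesis by (simp add: h_def)
  qed
  have h_ge: "\<eta> k \<le> h j k" for j k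
  proof (cases "k \<le> f j")
    case False
    \<comment> \<open>Past \<open>f j\<close> the floor \<open>s j\<close> protects
      \<open>\<eta>\<close>: it dominates \<open>\<eta>\<close> at the index
      \<open>f j div Suc j\<close>, which is at most \<open>k\<close>.\<close>
    then have "f j div Suc j \<le> k" by (meson div_le_dividend le_trans nat_le_linear)
    then have "\<eta> k \<le> \<eta> (f j div Suc j)" using eta(1) by (simp add: decseqD del: div_less)
    then show ?thesis using f1'[of j] le[of k] by (auto simp: h_def le_max_iff_disj)
  qed (simp add: h_above le)
  have h_dec: "h j n \<le> h j k" if "k \<le> n" for j k n
    unfolding h_def by (intro max.mono min.mono order_refl sq_mono t_pos decseqD[OF dec] that)
  have h_dbl: "h j (k div 2) \<le> M\<^sup>2 * h j k" for j k
  proof -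
    have "h j (k div 2) \<le> min (M\<^sup>2 * \<xi> k) (max (M\<^sup>2 * s j) (M\<^sup>2 * ((\<xi> k)\<^sup>2 / t j)))"
      unfolding h_def
      by (intro max.mono min.mono doubling' doubling_sq sq_le_M_sq_mult t_pos)
        (simp add: s_pos less_imp_le)
    also have "\<dots> = M\<^sup>2 * h j k"
      unfolding h_def by (simp add: max_mult_distrib_left min_mult_distrib_left)
    finally show ?thesis .
  qed
  define \<zeta> where "\<zeta> k = (INF j. h j k)" for k
  have bdd: "bdd_below (range (\<lambda>j. h j k))" for k using h_ge by (auto simp: bdd_below_def)
  have zeta_h: "\<zeta> k \<le> h j k" for j k unfolding \<zeta>_def by (rule cINF_lower[OF bdd]) simp
  have le_zeta: "c \<le> \<zeta> k" if "\<And>j. c \<le> h j k" for k c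
    unfolding \<zeta>_def using that by (intro cINF_greatest) auto
  have ge: "\<eta> k \<le> \<zeta> k" for k by (rule le_zeta) (rule h_ge)
  have le': "\<zeta> k \<le> \<xi> k" for k using zeta_h h_le by (rule order_trans)
  have dec': "decseq \<zeta>"
    unfolding decseq_def by (intro allI impI le_zeta) (meson h_dec zeta_h order_trans)
  have "\<zeta> \<in> c0_star"
    using ge eta(2) by (intro c0_star_between[OF dec' _ le' tendsto_0]) (meson order_trans)
  moreover have "Delta_half \<zeta>"
    unfolding Delta_half_def ampliation_def
  proof (intro exI allI)
    fix k
    \<comment> \<open>Lower bounds of an infimum can be checked termwise, so the constant is moved
      to the left.\<close>
    have "\<zeta> (k div 2) / M\<^sup>2 \<le> \<zeta> k"
    proof (rule le_zeta)
      fix j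
      show "\<zeta> (k div 2) / M\<^sup>2 \<le> h j k"
        using zeta_h[of "k div 2" j] h_dbl[of j k] M_ge_1 by (simp add: divide_le_eq mult.commute)
    qed
    then show "\<zeta> (k div 2) \<le> M\<^sup>2 * \<zeta> k" using M_ge_1 by (simp add: divide_le_eq mult.commute)
  qed
  \<comment> \<open>No dent is active at \<open>f j\<close>: for \<open>i < j\<close> the floor
    \<open>s i\<close> is already at least \<open>\<xi> (f j)\<close>, and for
    \<open>i \<ge> j\<close> the dent has not begun.\<close>
  moreover have zeta_f: "\<zeta> (f j) = t j" for j
  proof (rule antisym)
    show "t j \<le> \<zeta> (f j)"
    proof (rule le_zeta)
      fix i
      show "t j \<le> h i (f j)"
      proof (cases "i < j")
        case True
        then show ?thesis using f3[OF True] by (auto simp: h_def t_def le_max_iff_disj)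
      next
        case False
        then have "f j \<le> f i" using f3(1)[of j i] by (cases "i = j") auto
        then show ?thesis by (simp add: h_above t_def)
      qed
    qed
  qed (simp add: t_def le')
  \<comment> \<open>Monotonicity carries the positive values \<open>t j\<close> at the unboundedly
    large indices \<open>f j\<close> back to all indices.\<close>
  have "0 < \<zeta> k" for k
  proof -
    have "j \<le> f j" for j by (rule strict_mono_imp_increasing) (simp add: strict_mono_def f3(1))
    then have "\<zeta> (f k) \<le> \<zeta> k" using dec' by (simp add: decseqD)
    then show ?thesis using zeta_f[of k] t_pos[of k] by linarith
  qed
  moreover have "\<nexists>C. \<forall>k. \<zeta> k \<le> C * \<eta> (k div m)" if "0 < m" for m
  proof
    assume "\<exists>C. \<forall>k. \<zeta> k \<le> C * \<eta> (k div m)"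
    then obtain C where C: "\<And>k. \<zeta> k \<le> C * \<eta> (k div m)" by blast
    obtain j0 where j0: "C < real j0" using reals_Archimedean2 by blast
    \<comment> \<open>With \<open>j \<ge> m\<close> the ampliation of \<open>\<eta>\<close> by
      \<open>m\<close> is, at \<open>f j\<close>, at most the one by \<open>Suc j\<close>; with
      \<open>j \<ge> j0\<close> the gap \<open>real (Suc j)^2\<close> absorbs
      \<open>C\<close>.\<close>
    define j where "j = max m j0"
    have "\<eta> (f j div m) \<le> \<eta> (f j div Suc j)"
      using \<open>0 < m\<close> by (intro decseqD[OF eta(1)] div_le_mono2) (auto simp: j_def)
    then have *: "\<eta> (f j div m) \<le> t j / real (Suc j)^2" using f1'[of j] by (simp add: s_def)
    have "t j \<le> C * \<eta> (f j div m)" using C[of "f j"] by (simp add: zeta_f)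
    also have "\<dots> \<le> real (Suc j) * \<eta> (f j div m)"
      using j0 by (intro mult_right_mono eta(2)) (auto simp: j_def)
    also have "\<dots> \<le> real (Suc j) * (t j / real (Suc j)^2)" by (intro mult_left_mono *) simp
    also have "\<dots> = t j / real (Suc j)" by (simp add: power2_eq_square)
    finally have "t j * real (Suc j) \<le> t j" by (simp add: le_divide_eq)
    then have "j = 0" using t_pos[of j] by simp
    then show False using \<open>0 < m\<close> by (simp add: j_def)
  qed
  moreover have "\<nexists>C. \<forall>k. \<xi> k \<le> C * \<zeta> k"
  proof
    assume "\<exists>C. \<forall>k. \<xi> k \<le> C * \<zeta> k"
    then obtain C where C: "\<And>k. \<xi> k \<le> C * \<zeta> k" by blast
    have "0 < C * \<zeta> 0" using C[of 0] pos[of 0] by linarith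
    moreover have "0 \<le> \<zeta> 0" using ge[of 0] eta(2)[of 0] by linarith
    ultimately have C_pos: "0 < C" by (simp add: zero_less_mult_iff)
    obtain j where j: "C * M < real j" using reals_Archimedean2 by blast
    \<comment> \<open>At this level the two entries of the maximum balance: the floor equals
      \<open>v / real (Suc j)\<close>, and \<open>\<xi>\<^sup>2 / t j\<close> is about
      \<open>\<xi> / real (Suc j)\<close>, up to the factor \<open>M\<close>.\<close>
    define v where "v = t j / real (Suc j)"
    have "v \<le> t j" using t_pos[of j] by (simp add: v_def divide_le_eq mult_le_cancel_left1)
    also have "t j \<le> \<xi> 0" using dec by (simp add: t_def decseqD)
    finally obtain n where n: "v \<le> \<xi> n" "\<xi> n \<le> M * v"
      using exists_near_value[of \<xi> M v, OF tendsto_0 le_Suc] M_ge_1 t_pos[of j] by (auto simp: v_def)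
    have "s j = v / real (Suc j)" by (simp add: s_def v_def power2_eq_square)
    also have "\<dots> \<le> M * \<xi> n / real (Suc j)"
    proof (rule divide_right_mono)
      have "\<xi> n \<le> M * \<xi> n" using M_ge_1 pos[of n] by simp
      with n(1) show "v \<le> M * \<xi> n" by linarith
    qed simp
    finally have 1: "s j \<le> M * \<xi> n / real (Suc j)" .
    have "(\<xi> n)\<^sup>2 / t j \<le> (M * v) * \<xi> n / t j"
      using n(2) pos[of n] t_pos[of j] by (simp add: divide_right_mono power2_eq_square)
    also have "\<dots> = M * \<xi> n / real (Suc j)" using t_pos[of j] by (simp add: v_def)
    finally have "h j n \<le> M * \<xi> n / real (Suc j)" using 1 by (simp add: h_def min_le_iff_disj)
    then have "C * \<zeta> n \<le> C * (M * \<xi> n / real (Suc j))"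
      using zeta_h[of n j] C_pos by (intro mult_left_mono) auto
    then have "\<xi> n \<le> C * M * \<xi> n / real (Suc j)" using C[of n] by (simp add: mult_ac)
    then have "real (Suc j) * \<xi> n \<le> (C * M) * \<xi> n" by (simp add: le_divide_eq mult.commute)
    then show False using j pos[of n] by auto
  qed
  ultimately show ?thesis using ge le' by blast
qed

end

instance chilbert_space \<subseteq> banach ..

subsection \<open>Inner products\<close>

lemma cinner_add_left: "cinner (x + y) (z::'a::complex_inner) = cinner x z + cinner y z"
  by (metis cinner_add_right cinner_commute complex_cnj_add)

lemma cinner_scaleC_left: "cinner (c *\<^sub>C x) (y::'a::complex_inner) = cnj c * cinner x y"
  by (metis cinner_commute cinner_scaleC_right complex_cnj_mult)

lemma cinner_zero_right [simp]: "cinner (x::'a::complex_inner) 0 = 0"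
  using cinner_add_right[of x 0 0] by simp

lemma cinner_zero_left [simp]: "cinner 0 (x::'a::complex_inner) = 0"
  using cinner_add_left[of 0 0 x] by simp

lemma cinner_minus_right: "cinner (x::'a::complex_inner) (- y) = - cinner x y"
  using cinner_add_right[of x y "- y"] by (simp add: eq_neg_iff_add_eq_0 add.commute)

lemma cinner_diff_right: "cinner (x::'a::complex_inner) (y - z) = cinner x y - cinner x z"
  using cinner_add_right[of x y "- z"] by (simp add: cinner_minus_right)

lemma cinner_sum_right: "cinner (x::'a::complex_inner) (sum f A) = (\<Sum>i\<in>A. cinner x (f i))"
  by (induction A rule: infinite_finite_induct) (auto simp: cinner_add_right)

lemma cinner_scaleR_right: "cinner (x::'a::complex_inner) (r *\<^sub>R y) = of_real r * cinner x y"
  by (simp add: scaleR_scaleC cinner_scaleC_right)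

lemma cinner_scaleR_left: "cinner (r *\<^sub>R x) (y::'a::complex_inner) = of_real r * cinner x y"
  by (simp add: scaleR_scaleC cinner_scaleC_left)

lemma cinner_self: "cinner x (x::'a::complex_inner) = of_real ((norm x)\<^sup>2)"
proof (rule complex_eqI)
  have "Im (cinner x x) = - Im (cinner x x)" by (metis cinner_commute cnj.simps(2))
  then show "Im (cinner x x) = Im (of_real ((norm x)\<^sup>2))" by simp
  show "Re (cinner x x) = Re (of_real ((norm x)\<^sup>2))"
    using cinner_self_nonneg[of x] by (simp add: norm_eq_sqrt_cinner)
qed

lemma cinner_eq_0_commute: "cinner x (y::'a::complex_inner) = 0 \<longleftrightarrow> cinner y x = 0"
  by (metis cinner_commute complex_cnj_zero)

lemma norm_scaleC: "norm (c *\<^sub>C (x::'a::complex_inner)) = cmod c * norm x"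
proof -
  have "cinner (c *\<^sub>C x) (c *\<^sub>C x) = (c * cnj c) * cinner x x"
    by (simp only: cinner_scaleC_left cinner_scaleC_right mult_ac)
  also have "\<dots> = of_real ((cmod c * norm x)\<^sup>2)"
    by (simp only: cinner_self complex_norm_square[symmetric] of_real_mult[symmetric]
        power_mult_distrib)
  finally have "(norm (c *\<^sub>C x))\<^sup>2 = (cmod c * norm x)\<^sup>2"
    unfolding cinner_self of_real_eq_iff .
  then show ?thesis by (simp add: power2_eq_iff_nonneg)
qed

lemma norm_add_sq:
  "(norm (x + (y::'a::complex_inner)))\<^sup>2 = (norm x)\<^sup>2 + 2 * Re (cinner x y) + (norm y)\<^sup>2"
proof -
  have "cinner (x + y) (x + y) = cinner x x + (cinner x y + cnj (cinner x y)) + cinner y y"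
    by (simp add: cinner_add_left cinner_add_right cinner_commute[of y x])
  also have "\<dots> = of_real ((norm x)\<^sup>2 + 2 * Re (cinner x y) + (norm y)\<^sup>2)"
    by (simp only: cinner_self complex_add_cnj of_real_add)
  finally show ?thesis unfolding cinner_self of_real_eq_iff .
qed

lemma norm_diff_sq:
  "(norm (x - (y::'a::complex_inner)))\<^sup>2 = (norm x)\<^sup>2 - 2 * Re (cinner x y) + (norm y)\<^sup>2"
  using norm_add_sq[of x "- y"] by (simp add: cinner_minus_right)

lemma parallelogram_law:
  "(norm (x + y))\<^sup>2 + (norm (x - (y::'a::complex_inner)))\<^sup>2 = 2 * (norm x)\<^sup>2 + 2 * (norm y)\<^sup>2"
  by (simp add: norm_add_sq norm_diff_sq)

subsection \<open>Orthogonal families\<close>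

text \<open>Zero vectors are admitted so that the left singular vectors of a finite rank operator form
  such a family.\<close>

definition suborthonormal :: "('i \<Rightarrow> 'a::complex_inner) \<Rightarrow> bool" where
  "suborthonormal a \<longleftrightarrow> (\<forall>i j. i \<noteq> j \<longrightarrow> cinner (a i) (a j) = 0) \<and> (\<forall>i. norm (a i) \<le> 1)"

definition orthonormal :: "('i \<Rightarrow> 'a::complex_inner) \<Rightarrow> bool" where
  "orthonormal a \<longleftrightarrow> (\<forall>i j. cinner (a i) (a j) = (if i = j then 1 else 0))"

lemma suborthonormalD:
  assumes "suborthonormal a"
  shows "i \<noteq> j \<Longrightarrow> cinner (a i) (a j) = 0" "norm (a i) \<le> 1"
  using assms by (auto simp: suborthonormal_def)

lemma orthonormalD:
  assumes "orthonormal a"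
  shows "cinner (a i) (a j) = (if i = j then 1 else 0)" "norm (a i) = 1"
  using assms cinner_self[of "a i"] by (auto simp: orthonormal_def norm_eq_sqrt_cinner)

lemma orthonormal_imp_suborthonormal: "orthonormal a \<Longrightarrow> suborthonormal a"
  by (auto simp: suborthonormal_def orthonormalD)

lemma norm_sq_sum_orthogonal:
  assumes "\<And>i j. i \<noteq> j \<Longrightarrow> cinner (b i) (b j :: 'a::complex_inner) = 0"
  shows "(norm (\<Sum>i\<in>A. z i *\<^sub>C b i))\<^sup>2 = (\<Sum>i\<in>A. (cmod (z i))\<^sup>2 * (norm (b i))\<^sup>2)"
proof (induction A rule: infinite_finite_induct)
  case (insert k A)
  have "cinner (b k) (b i) = 0" if "i \<in> A" for i
    using assms[of k i] insert.hyps(2) that by auto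
  then have "cinner (z k *\<^sub>C b k) (\<Sum>i\<in>A. z i *\<^sub>C b i) = 0"
    by (simp add: cinner_sum_right cinner_scaleC_left cinner_scaleC_right)
  then show ?case
    using insert by (simp add: norm_add_sq norm_scaleC power_mult_distrib)
qed auto

lemma norm_sq_sum_suborthonormal_le:
  assumes "suborthonormal b"
  shows "(norm (\<Sum>i\<in>A. z i *\<^sub>C b i))\<^sup>2 \<le> (\<Sum>i\<in>A. (cmod (z i))\<^sup>2)"
proof -
  have "(norm (\<Sum>i\<in>A. z i *\<^sub>C b i))\<^sup>2 = (\<Sum>i\<in>A. (cmod (z i))\<^sup>2 * (norm (b i))\<^sup>2)"
    by (rule norm_sq_sum_orthogonal) (rule suborthonormalD(1)[OF assms])
  also have "\<dots> \<le> (\<Sum>i\<in>A. (cmod (z i))\<^sup>2)"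
    using suborthonormalD(2)[OF assms] by (intro sum_mono mult_left_le) (auto intro: power_le_one)
  finally show ?thesis .
qed

text \<open>Expand the square of the distance from \<open>x\<close> to \<open>?p\<close>. As the
  \<open>a i\<close> may be shorter than unit vectors, the squared norm of \<open>?p\<close> is only
  bounded by the sum \<open>?S\<close>, which is the direction required.\<close>

lemma bessel_finite:
  assumes "suborthonormal a"
  shows "(\<Sum>i\<in>A. (cmod (cinner (a i) x))\<^sup>2) \<le> (norm x)\<^sup>2"
proof -
  let ?z = "\<lambda>i. cinner (a i) x" and ?S = "\<Sum>i\<in>A. (cmod (cinner (a i) x))\<^sup>2"
  let ?p = "\<Sum>i\<in>A. ?z i *\<^sub>C a i"
  have "?z i * cinner x (a i) = of_real ((cmod (?z i))\<^sup>2)" for i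
    unfolding cinner_commute[of x "a i"] by (rule complex_norm_square[symmetric])
  then have "cinner x ?p = of_real ?S"
    by (simp only: cinner_sum_right cinner_scaleC_right of_real_sum)
  then have "0 \<le> (norm x)\<^sup>2 - 2 * ?S + (norm ?p)\<^sup>2"
    using norm_diff_sq[of x ?p] zero_le_power2[of "norm (x - ?p)"] by (simp only: Re_complex_of_real)
  with norm_sq_sum_suborthonormal_le[OF assms, of ?z A] show ?thesis by linarith
qed

text \<open>This is Bessel's inequality for the one-member family formed by the normalized
  \<open>x\<close>.\<close>

lemma cauchy_schwarz: "cmod (cinner x (y::'a::complex_inner)) \<le> norm x * norm y"
proof (cases "x = 0")
  case False
  define u where "u = inverse (norm x) *\<^sub>R x"
  have "norm u = 1" using False by (simp add: u_def)
  then have "(cmod (cinner u y))\<^sup>2 \<le> (norm y)\<^sup>2"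
    using bessel_finite[of "\<lambda>_::unit. u" y UNIV] by (simp add: suborthonormal_def)
  then have "cmod (cinner u y) \<le> norm y" by (rule power2_le_imp_le) simp
  moreover have "cmod (cinner u y) = inverse (norm x) * cmod (cinner x y)"
    by (simp add: u_def cinner_scaleR_left norm_mult norm_inverse)
  ultimately show ?thesis using False by (simp add: field_simps)
qed simp

lemma bounded_linear_cinner: "bounded_linear (cinner (a::'a::complex_inner))"
proof (rule bounded_linear_intro)
  show "norm (cinner a y) \<le> norm y * norm a" for y
    using cauchy_schwarz[of a y] by (simp add: mult.commute)
qed (auto simp: cinner_add_right cinner_scaleR_right scaleR_conv_of_real)

lemma summable_bessel:
  assumes "suborthonormal (a :: nat \<Rightarrow> 'a::complex_inner)"
  shows "summable (\<lambda>n. (cmod (cinner (a n) x))\<^sup>2)" "(\<Sum>n. (cmod (cinner (a n) x))\<^sup>2) \<le> (norm x)\<^sup>2"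
proof -
  show "summable (\<lambda>n. (cmod (cinner (a n) x))\<^sup>2)"
    by (rule summableI_nonneg_bounded[where x = "(norm x)\<^sup>2"]) (auto intro: bessel_finite[OF assms])
  then show "(\<Sum>n. (cmod (cinner (a n) x))\<^sup>2) \<le> (norm x)\<^sup>2"
    by (rule suminf_le_const) (rule bessel_finite[OF assms])
qed

text \<open>The series need not converge absolutely; Pythagoras on blocks transfers the Cauchy
  criterion from the squared coefficients.\<close>

lemma summable_suborthonormal:
  assumes b: "suborthonormal (b :: nat \<Rightarrow> 'a::chilbert_space)"
    and z: "summable (\<lambda>n. (cmod (z n))\<^sup>2)"
  shows "summable (\<lambda>n. z n *\<^sub>C b n)" "(norm (\<Sum>n. z n *\<^sub>C b n))\<^sup>2 \<le> (\<Sum>n. (cmod (z n))\<^sup>2)"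
proof -
  show sm: "summable (\<lambda>n. z n *\<^sub>C b n)"
    unfolding summable_Cauchy
  proof (intro allI impI)
    fix e :: real assume "e > 0"
    then have "0 < e\<^sup>2" by simp
    then obtain N where N: "\<And>m n. m \<ge> N \<Longrightarrow> norm (\<Sum>i\<in>{m..<n}. (cmod (z i))\<^sup>2) < e\<^sup>2"
      using z unfolding summable_Cauchy by blast
    have "norm (\<Sum>i\<in>{m..<n}. z i *\<^sub>C b i) < e" if "m \<ge> N" for m n
    proof (rule power2_less_imp_less)
      show "(norm (\<Sum>i\<in>{m..<n}. z i *\<^sub>C b i))\<^sup>2 < e\<^sup>2"
        using norm_sq_sum_suborthonormal_le[OF b, of z "{m..<n}"] N[OF that, of n]
        by (auto simp: sum_nonneg)
    qed (use \<open>e > 0\<close> in simp)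
    then show "\<exists>N. \<forall>m\<ge>N. \<forall>n. norm (\<Sum>i\<in>{m..<n}. z i *\<^sub>C b i) < e" by blast
  qed
  have "(\<lambda>n. (norm (\<Sum>i<n. z i *\<^sub>C b i))\<^sup>2) \<longlonglongrightarrow> (norm (\<Sum>n. z n *\<^sub>C b n))\<^sup>2"
    by (intro tendsto_intros summable_LIMSEQ sm)
  then show "(norm (\<Sum>n. z n *\<^sub>C b n))\<^sup>2 \<le> (\<Sum>n. (cmod (z n))\<^sup>2)"
  proof (rule LIMSEQ_le_const2, intro exI allI impI)
    fix n
    show "(norm (\<Sum>i<n. z i *\<^sub>C b i))\<^sup>2 \<le> (\<Sum>n. (cmod (z n))\<^sup>2)"
      using norm_sq_sum_suborthonormal_le[OF b, of z "{..<n}"] sum_le_suminf[OF z, of "{..<n}"]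
      by auto
  qed
qed

subsection \<open>Bounded operators\<close>

lemma bounded_op_imp_bounded_linear: "bounded_op A \<Longrightarrow> bounded_linear A"
  by (simp add: bounded_op_def)

lemma bounded_op_scaleC: "bounded_op A \<Longrightarrow> A (c *\<^sub>C x) = c *\<^sub>C A x"
  by (simp add: bounded_op_def)

lemmas bounded_op_add = linear_add[OF bounded_linear.linear[OF bounded_op_imp_bounded_linear]]
lemmas bounded_op_zero = linear_0[OF bounded_linear.linear[OF bounded_op_imp_bounded_linear]]
lemmas bounded_op_sum = linear_sum[OF bounded_linear.linear[OF bounded_op_imp_bounded_linear]]

lemma bounded_op_compose: "bounded_op A \<Longrightarrow> bounded_op B \<Longrightarrow> bounded_op (A \<circ> B)"
  using bounded_linear_compose[of A B] by (auto simp: bounded_op_def o_def)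

lemma bounded_op_plus: "bounded_op A \<Longrightarrow> bounded_op B \<Longrightarrow> bounded_op (\<lambda>x. A x + B x)"
  by (auto simp: bounded_op_def scaleC_add_right intro: bounded_linear_add)

lemma bounded_op_0: "bounded_op (\<lambda>x. 0)"
  by (simp add: bounded_op_def)

lemma bounded_op_plus_sum:
  "(\<And>r. r \<in> R \<Longrightarrow> bounded_op (F r)) \<Longrightarrow> bounded_op (\<lambda>x. \<Sum>r\<in>R. F r x)"
  by (induction R rule: infinite_finite_induct) (auto intro: bounded_op_0 bounded_op_plus)

text \<open>The set where \<open>A\<close> and \<open>B\<close> agree is a closed subspace
  containing every \<open>e n\<close>.\<close>

lemma bounded_op_eqI:
  fixes e :: "nat \<Rightarrow> 'a::chilbert_space"
  assumes e: "orthonormal_basis e" and AB: "bounded_op A" "bounded_op B" "\<And>n. A (e n) = B (e n)"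
  shows "A = B"
proof -
  have "closed {x. A x = B x}"
    using AB(1,2) by (intro closed_Collect_eq linear_continuous_on bounded_op_imp_bounded_linear)
  moreover have "A x = B x" if "x \<in> complex_vector.span (range e)" for x
    using that
  proof (induction rule: complex_vector.span_induct)
    case base
    show ?case
      using AB by (auto simp: complex_vector.subspace_def bounded_op_add bounded_op_zero
          bounded_op_scaleC)
  qed (use AB(3) in auto)
  ultimately have "closure (complex_vector.span (range e)) \<subseteq> {x. A x = B x}"
    by (intro closure_minimal) auto
  then show ?thesis using e by (auto simp: orthonormal_basis_def)
qed

text \<open>Isometries, their adjoints and diagonal operators are all of this form.\<close>

definition diag_map :: "(nat \<Rightarrow> 'a) \<Rightarrow> (nat \<Rightarrow> real) \<Rightarrow> (nat \<Rightarrow> 'a) \<Rightarrow> 'a \<Rightarrow> 'a::chilbert_space" where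
  "diag_map a c b x = (\<Sum>n. (complex_of_real (c n) * cinner (a n) x) *\<^sub>C b n)"

lemma diag_op_eq_diag_map: "diag_op e \<xi> = diag_map e \<xi> e"
  by (simp add: fun_eq_iff diag_op_def diag_map_def)

text \<open>Bounding \<open>c n\<close> only after multiplication by the coefficient of
  \<open>x\<close> frees the indices where that coefficient vanishes. The estimate thus also covers
  vectors orthogonal to the first few \<open>a n\<close>, as Gelfand numbers require.\<close>

lemma summable_norm_le_diag_map:
  assumes a: "suborthonormal a" and b: "suborthonormal b" and "0 \<le> K"
    and K: "\<And>n. \<bar>c n\<bar> * cmod (cinner (a n) x) \<le> K * cmod (cinner (a n) x)"
  shows "summable (\<lambda>n. (complex_of_real (c n) * cinner (a n) x) *\<^sub>C b n)"
    and "norm (diag_map a c b x) \<le> K * norm x"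
proof -
  let ?z = "\<lambda>n. complex_of_real (c n) * cinner (a n) x"
  let ?w = "\<lambda>n. (cmod (cinner (a n) x))\<^sup>2"
  have le: "(cmod (?z n))\<^sup>2 \<le> K\<^sup>2 * ?w n" for n
    using power_mono[OF K[of n], of 2] by (simp add: norm_mult power_mult_distrib)
  have smw: "summable (\<lambda>n. K\<^sup>2 * ?w n)" using summable_bessel(1)[OF a] by (rule summable_mult)
  have sm: "summable (\<lambda>n. (cmod (?z n))\<^sup>2)"
    by (rule summable_comparison_test'[OF smw]) (use le in auto)
  show "summable (\<lambda>n. ?z n *\<^sub>C b n)" by (rule summable_suborthonormal(1)[OF b sm])
  have "(norm (diag_map a c b x))\<^sup>2 \<le> (\<Sum>n. (cmod (?z n))\<^sup>2)"
    unfolding diag_map_def by (rule summable_suborthonormal(2)[OF b sm])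
  also have "\<dots> \<le> (\<Sum>n. K\<^sup>2 * ?w n)" by (rule suminf_le[OF le sm smw])
  also have "\<dots> = K\<^sup>2 * (\<Sum>n. ?w n)" by (rule suminf_mult[OF summable_bessel(1)[OF a]])
  also have "\<dots> \<le> K\<^sup>2 * (norm x)\<^sup>2" by (intro mult_left_mono summable_bessel(2)[OF a]) simp
  finally have "(norm (diag_map a c b x))\<^sup>2 \<le> (K * norm x)\<^sup>2" unfolding power_mult_distrib .
  then show "norm (diag_map a c b x) \<le> K * norm x"
    by (rule power2_le_imp_le) (use \<open>0 \<le> K\<close> in simp)
qed

lemma bounded_op_diag_map:
  assumes a: "suborthonormal a" and b: "suborthonormal b" and K: "\<And>n. \<bar>c n\<bar> \<le> K"
  shows "bounded_op (diag_map a c b)"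
proof -
  have "0 \<le> K" using K[of 0] by linarith
  note D = summable_norm_le_diag_map[OF a b this mult_right_mono[OF K norm_ge_zero]]
  have C: "diag_map a c b (z *\<^sub>C x) = z *\<^sub>C diag_map a c b x" for z x
  proof -
    have "bounded_linear (\<lambda>y::'a. z *\<^sub>C y)"
      by (rule bounded_linear_intro[where K = "cmod z"])
        (auto simp: scaleC_add_right scaleR_scaleC scaleC_scaleC norm_scaleC mult.commute)
    from bounded_linear.suminf[OF this D(1)] show ?thesis
      unfolding diag_map_def by (simp only: cinner_scaleC_right scaleC_scaleC mult.left_commute)
  qed
  have "bounded_linear (diag_map a c b)"
  proof (rule bounded_linear_intro)
    show "diag_map a c b (x + y) = diag_map a c b x + diag_map a c b y" for x y
      unfolding diag_map_def suminf_add[OF D(1) D(1)]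
      by (simp add: cinner_add_right distrib_left scaleC_add_left)
    show "diag_map a c b (r *\<^sub>R x) = r *\<^sub>R diag_map a c b x" for r x
      unfolding scaleR_scaleC by (rule C)
    show "norm (diag_map a c b x) \<le> norm x * K" for x
      unfolding mult.commute[of _ K] by (rule D(2))
  qed
  with C show ?thesis by (simp add: bounded_op_def)
qed

lemma diag_map_single:
  assumes "\<And>n. n \<noteq> k \<Longrightarrow> cinner (a n) x = 0"
  shows "diag_map a c b x = (complex_of_real (c k) * cinner (a k) x) *\<^sub>C b k"
  unfolding diag_map_def by (subst suminf_finite[of "{k}"]) (use assms in auto)

lemma diag_map_apply:
  "orthonormal a \<Longrightarrow> diag_map a c b (a k) = complex_of_real (c k) *\<^sub>C b k"
  by (subst diag_map_single[of k]) (auto simp: orthonormalD)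

lemma cinner_diag_map:
  assumes "suborthonormal a" "orthonormal b" "\<And>n. \<bar>c n\<bar> \<le> K"
  shows "cinner (b k) (diag_map a c b x) = complex_of_real (c k) * cinner (a k) x"
proof -
  have "0 \<le> K" using assms(3)[of 0] by linarith
  have "cinner (b k) (diag_map a c b x)
      = (\<Sum>n. cinner (b k) ((complex_of_real (c n) * cinner (a n) x) *\<^sub>C b n))"
    unfolding diag_map_def
    by (intro bounded_linear.suminf bounded_linear_cinner
        summable_norm_le_diag_map(1)[OF assms(1) orthonormal_imp_suborthonormal[OF assms(2)] \<open>0 \<le> K\<close>]
        mult_right_mono assms(3)) simp
  also have "\<dots> = complex_of_real (c k) * cinner (a k) x"
    by (subst suminf_finite[of "{k}"]) (auto simp: cinner_scaleC_right orthonormalD[OF assms(2)])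
  finally show ?thesis .
qed

lemma diag_map_sum_apply:
  assumes "orthonormal a" "bounded_op (diag_map a c b)"
  shows "diag_map a c b (\<Sum>j\<in>J. z j *\<^sub>C a j) = (\<Sum>j\<in>J. (z j * complex_of_real (c j)) *\<^sub>C b j)"
  using assms by (simp add: bounded_op_sum bounded_op_scaleC diag_map_apply scaleC_scaleC)

subsection \<open>Compact operators and ideals\<close>

text \<open>Allows any compact superset of the image as a witness, so that closures of images need
  not be computed.\<close>

lemma compact_op_iff:
  "compact_op T \<longleftrightarrow> bounded_op T \<and> (\<exists>K. compact K \<and> T ` cball 0 1 \<subseteq> K)"
proof -
  have "compact (closure S)" if "compact K" "S \<subseteq> K" for S K :: "'a set"
  proof -
    have "closure S \<subseteq> K" using that by (simp add: closure_minimal compact_imp_closed)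
    then show ?thesis using compact_Int_closed[OF \<open>compact K\<close> closed_closure, of S]
      by (simp add: Int_absorb1)
  qed
  moreover have "compact (closure (T ` cball 0 1)) \<Longrightarrow> \<exists>K. compact K \<and> T ` cball 0 1 \<subseteq> K"
    by (intro exI[of _ "closure (T ` cball 0 1)"] conjI closure_subset)
  ultimately have "compact (closure (T ` cball 0 1)) \<longleftrightarrow> (\<exists>K. compact K \<and> T ` cball 0 1 \<subseteq> K)"
    by metis
  then show ?thesis by (simp add: compact_op_def)
qed

lemma compact_op_imp_bounded_op: "compact_op T \<Longrightarrow> bounded_op T"
  by (simp add: compact_op_def)

lemma compact_op_0: "compact_op (\<lambda>x. 0)"
  unfolding compact_op_iff by (intro conjI bounded_op_0 exI[of _ "{0}"]) auto

lemma compact_op_plus: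
  assumes "compact_op S" "compact_op T"
  shows "compact_op (\<lambda>x. S x + T x)"
proof -
  obtain K L where K: "compact K" "S ` cball 0 1 \<subseteq> K" and L: "compact L" "T ` cball 0 1 \<subseteq> L"
    using assms unfolding compact_op_iff by blast
  have "compact {x + y |x y. x \<in> K \<and> y \<in> L}" using K(1) L(1) by (rule compact_sums)
  moreover have "(\<lambda>x. S x + T x) ` cball 0 1 \<subseteq> {x + y |x y. x \<in> K \<and> y \<in> L}"
    using K(2) L(2) by blast
  ultimately show ?thesis
    using assms unfolding compact_op_iff by (blast intro: bounded_op_plus)
qed

lemma compact_op_compose:
  assumes T: "compact_op T" and A: "bounded_op A" and B: "bounded_op B"
  shows "compact_op (A \<circ> T \<circ> B)"
proof -
  obtain K where K: "compact K" "T ` cball 0 1 \<subseteq> K"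
    using T unfolding compact_op_iff by blast
  obtain R where R: "0 < R" "\<And>x. norm (B x) \<le> norm x * R"
    using bounded_linear.pos_bounded[OF bounded_op_imp_bounded_linear[OF B]] by blast
  \<comment> \<open>\<open>B\<close> maps the unit ball into the ball of radius \<open>R\<close>, on
    which homogeneity reduces \<open>T\<close> to the unit ball.\<close>
  have "compact (A ` (\<lambda>y. R *\<^sub>R y) ` K)"
    using K(1) A
    by (intro compact_continuous_image compact_scaling linear_continuous_on
        bounded_op_imp_bounded_linear)
  moreover have "(A \<circ> T \<circ> B) ` cball 0 1 \<subseteq> A ` (\<lambda>y. R *\<^sub>R y) ` K"
  proof clarsimp
    fix x :: 'a assume "norm x \<le> 1"
    then have "norm (B x) \<le> R" using R(2)[of x] mult_right_mono[of "norm x" 1 R] R(1) by linarith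
    then have "inverse R *\<^sub>R B x \<in> cball 0 1" using R(1) by (simp add: field_simps)
    then have "T (inverse R *\<^sub>R B x) \<in> K" using K(2) by blast
    moreover have "T (B x) = R *\<^sub>R T (inverse R *\<^sub>R B x)"
      using R(1) compact_op_imp_bounded_op[OF T] by (simp add: scaleR_scaleC bounded_op_scaleC scaleC_scaleC scaleC_one)
    ultimately show "A (T (B x)) \<in> A ` (\<lambda>y. R *\<^sub>R y) ` K" by blast
  qed
  ultimately show ?thesis
    using A B T unfolding compact_op_iff by (blast intro: bounded_op_compose)
qed

lemma operator_idealD:
  assumes "operator_ideal I"
  shows "T \<in> I \<Longrightarrow> compact_op T" "(\<lambda>x. 0) \<in> I"
    "S \<in> I \<Longrightarrow> T \<in> I \<Longrightarrow> (\<lambda>x. S x + T x) \<in> I"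
    "T \<in> I \<Longrightarrow> bounded_op A \<Longrightarrow> bounded_op B \<Longrightarrow> A \<circ> T \<circ> B \<in> I"
  using assms by (auto simp: operator_ideal_def)

lemma operator_ideal_sum:
  assumes "operator_ideal I" "\<And>r. r \<in> R \<Longrightarrow> F r \<in> I"
  shows "(\<lambda>x. \<Sum>r\<in>R. F r x) \<in> I"
  using assms(2)
  by (induction R rule: infinite_finite_induct) (auto intro: operator_idealD(2,3)[OF assms(1)])

lemma operator_ideal_compact: "operator_ideal {T. compact_op T}"
  unfolding operator_ideal_def by (auto intro: compact_op_0 compact_op_plus compact_op_compose)

lemma operator_ideal_zero: "operator_ideal {\<lambda>x. 0}"
  by (auto simp: operator_ideal_def compact_op_0 o_def bounded_op_zero fun_eq_iff)

lemma mem_principal_ideal: "X \<in> principal_ideal X"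
  by (auto simp: principal_ideal_def)

lemma principal_ideal_least: "operator_ideal I \<Longrightarrow> X \<in> I \<Longrightarrow> principal_ideal X \<subseteq> I"
  by (auto simp: principal_ideal_def)

lemma principal_ideal_mono:
  "(\<And>I. operator_ideal I \<Longrightarrow> Y \<in> I \<Longrightarrow> X \<in> I) \<Longrightarrow> principal_ideal X \<subseteq> principal_ideal Y"
  by (auto simp: principal_ideal_def)

lemma compact_op_of_mem_principal_ideal: "compact_op X \<Longrightarrow> T \<in> principal_ideal X \<Longrightarrow> compact_op T"
  using principal_ideal_least[OF operator_ideal_compact, of X] by auto

subsection \<open>Principal ideals of diagonal operators\<close>

lemma orthonormal_basis_imp_orthonormal: "orthonormal_basis e \<Longrightarrow> orthonormal e"
  by (simp add: orthonormal_basis_def orthonormal_def)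

lemma c0_starD:
  assumes "\<xi> \<in> c0_star"
  shows "0 \<le> \<xi> k" "decseq \<xi>" "\<xi> \<longlonglongrightarrow> 0" "j \<le> k \<Longrightarrow> \<xi> k \<le> \<xi> j" "\<bar>\<xi> k\<bar> \<le> \<xi> 0"
  using assms by (auto simp: c0_star_def decseq_def)

lemma bounded_op_diag_op:
  assumes "orthonormal e" "\<xi> \<in> c0_star"
  shows "bounded_op (diag_op e \<xi>)"
  unfolding diag_op_eq_diag_map
  using assms by (intro bounded_op_diag_map[where K = "\<xi> 0"] orthonormal_imp_suborthonormal c0_starD)

lemma diag_op_apply: "orthonormal e \<Longrightarrow> diag_op e \<xi> (e k) = complex_of_real (\<xi> k) *\<^sub>C e k"
  unfolding diag_op_eq_diag_map by (rule diag_map_apply)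

text \<open>Splitting the index set into residue classes modulo \<open>m\<close>, each block of \<open>diag \<xi>\<close> factors
  through \<open>diag \<eta>\<close>.\<close>

lemma diag_op_mem_ideal:
  assumes e: "orthonormal_basis e" and \<xi>: "\<xi> \<in> c0_star" and \<eta>: "\<eta> \<in> c0_star"
    and I: "operator_ideal I" "diag_op e \<eta> \<in> I" and "0 < m"
    and le: "\<And>k. \<xi> k \<le> C * \<eta> (k div m)"
  shows "diag_op e \<xi> \<in> I"
proof -
  have on: "orthonormal e" using e by (rule orthonormal_basis_imp_orthonormal)
  \<comment> \<open>\<open>a r\<close> lists the basis vectors whose index is congruent to
    \<open>r\<close> modulo \<open>m\<close>. \<open>B r\<close> moves \<open>a r k\<close> to
    \<open>e k\<close>, and \<open>A r\<close> moves it back with the missing weight.\<close>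
  define a where "a r k = e (m * k + r)" for r k
  define A where "A r = diag_map e (\<lambda>k. \<xi> (m * k + r) / \<eta> k) (a r)" for r
  define B where "B r = diag_map (a r) (\<lambda>_. 1) e" for r
  have a: "orthonormal (a r)" for r
    using \<open>0 < m\<close> by (simp add: orthonormal_def a_def orthonormalD[OF on])
  have "\<bar>\<xi> (m * k + r) / \<eta> k\<bar> \<le> \<bar>C\<bar>" if "r < m" for k r
  \<comment> \<open>Where \<open>\<eta> k = 0\<close> the quotient is \<open>0\<close> by the
    convention on division. This is the right value, since \<open>le\<close> then forces the
    corresponding entries of \<open>\<xi>\<close> to vanish.\<close>
  proof (cases "\<eta> k = 0")
    case False
    then have "0 < \<eta> k" using c0_starD(1)[OF \<eta>, of k] by simp
    have "\<xi> (m * k + r) \<le> C * \<eta> k" using le[of "m * k + r"] that by simp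
    also have "\<dots> \<le> \<bar>C\<bar> * \<eta> k" using \<open>0 < \<eta> k\<close> by simp
    finally show ?thesis using \<open>0 < \<eta> k\<close> c0_starD(1)[OF \<xi>] by (simp add: divide_le_eq)
  qed simp
  then have A: "bounded_op (A r)" if "r < m" for r
    unfolding A_def using on a that
    by (intro bounded_op_diag_map[where K = "\<bar>C\<bar>"] orthonormal_imp_suborthonormal)
  have B: "bounded_op (B r)" for r
    unfolding B_def using on a
    by (intro bounded_op_diag_map[where K = 1] orthonormal_imp_suborthonormal) simp_all
  have ABe: "A r (diag_op e \<eta> (B r (e n))) = (if n mod m = r then complex_of_real (\<xi> n) *\<^sub>C e n else 0)"
    if "r < m" for r n
  proof (cases "n mod m = r")
    case True
    define k where "k = n div m"
    have n: "n = m * k + r" using True mult_div_mod_eq[of m n] by (simp add: k_def)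
    have "A r (diag_op e \<eta> (B r (e n)))
        = complex_of_real (\<eta> k) *\<^sub>C complex_of_real (\<xi> n / \<eta> k) *\<^sub>C e n"
      using on diag_map_apply[OF a, of r "\<lambda>_. 1" e k] diag_map_apply[OF on, of "\<lambda>k. \<xi> (m * k + r) / \<eta> k" "a r" k]
      by (simp add: A_def[symmetric] B_def[symmetric] a_def n[symmetric] scaleC_one diag_op_apply
          bounded_op_scaleC[OF A[OF that]])
    also have "\<dots> = complex_of_real (\<xi> n) *\<^sub>C e n"
    proof (cases "\<eta> k = 0")
      case True
      then have "\<xi> n = 0" using le[of n] c0_starD(1)[OF \<xi>, of n] by (simp add: k_def)
      with True show ?thesis by (simp add: complex_vector.scale_zero_left)
    qed (simp add: scaleC_scaleC)
    finally show ?thesis using True by simp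
  next
    case False
    have "cinner (a r k) (e n) = 0" for k
      using False that by (auto simp: a_def orthonormalD[OF on])
    \<comment> \<open>All coefficients vanish, so the index \<open>0\<close> is an arbitrary
      choice.\<close>
    then have "B r (e n) = 0" unfolding B_def by (subst diag_map_single[of 0]) simp_all
    then show ?thesis
      using False A[OF that] by (simp add: bounded_op_zero bounded_op_diag_op[OF on \<eta>])
  qed
  have "diag_op e \<xi> = (\<lambda>x. \<Sum>r<m. (A r \<circ> diag_op e \<eta> \<circ> B r) x)"
  proof (rule bounded_op_eqI[OF e bounded_op_diag_op[OF on \<xi>]])
    show "bounded_op (\<lambda>x. \<Sum>r<m. (A r \<circ> diag_op e \<eta> \<circ> B r) x)"
      using A B bounded_op_diag_op[OF on \<eta>]
      by (intro bounded_op_plus_sum bounded_op_compose) auto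
    show "diag_op e \<xi> (e n) = (\<Sum>r<m. (A r \<circ> diag_op e \<eta> \<circ> B r) (e n))" for n
      using \<open>0 < m\<close> by (simp add: diag_op_apply[OF on] ABe sum.delta')
  qed
  also have "\<dots> \<in> I"
    using A B by (intro operator_ideal_sum[OF I(1)] operator_idealD(4)[OF I]) auto
  finally show ?thesis .
qed

section \<open>Gelfand numbers and the comparison of diagonal operators\<close>

definition clinear_functional :: "('a::complex_vector \<Rightarrow> complex) \<Rightarrow> bool" where
  "clinear_functional \<phi> \<longleftrightarrow>
     (\<forall>x y. \<phi> (x + y) = \<phi> x + \<phi> y) \<and> (\<forall>c x. \<phi> (c *\<^sub>C x) = c * \<phi> x)"

lemma clinear_functional_cinner: "clinear_functional (cinner (a::'a::complex_inner))"
  by (simp add: clinear_functional_def cinner_add_right cinner_scaleC_right)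

text \<open>The \<open>k\<close>-th Gelfand number of \<open>T\<close> is at most \<open>\<delta>\<close>. The functionals need not be continuous,
  which makes the passage from \<open>T\<close> to \<open>T \<circ> B\<close> immediate, without adjoints.\<close>

definition gelfand_le :: "('a::chilbert_space \<Rightarrow> 'a) \<Rightarrow> nat \<Rightarrow> real \<Rightarrow> bool" where
  "gelfand_le T k \<delta> \<longleftrightarrow> (\<exists>\<phi>. (\<forall>i. clinear_functional (\<phi> i)) \<and>
     (\<forall>x. (\<forall>i<k. \<phi> i x = 0) \<longrightarrow> norm (T x) \<le> \<delta> * norm x))"

lemma gelfand_le_mono:
  assumes "gelfand_le T k \<delta>" "k \<le> l" "\<delta> \<le> \<epsilon>"
  shows "gelfand_le T l \<epsilon>"
proof -
  obtain \<phi> where \<phi>: "\<And>i. clinear_functional (\<phi> i)"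
    "\<And>x. \<forall>i<k. \<phi> i x = 0 \<Longrightarrow> norm (T x) \<le> \<delta> * norm x"
    using assms(1) unfolding gelfand_le_def by blast
  have "norm (T x) \<le> \<epsilon> * norm x" if "\<forall>i<l. \<phi> i x = 0" for x
    using \<phi>(2)[of x] that assms(2) mult_right_mono[OF assms(3), of "norm x"] by force
  with \<phi>(1) show ?thesis unfolding gelfand_le_def by blast
qed

lemma gelfand_le_0: "0 \<le> \<delta> \<Longrightarrow> gelfand_le (\<lambda>x. 0) k \<delta>"
  unfolding gelfand_le_def by (rule exI[of _ "\<lambda>_ _. 0"]) (simp add: clinear_functional_def)

text \<open>Both lists of functionals are concatenated; on their common kernel both estimates
  hold.\<close>

lemma gelfand_le_plus:
  assumes "gelfand_le S k \<delta>" "gelfand_le T l \<epsilon>"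
  shows "gelfand_le (\<lambda>x. S x + T x) (k + l) (\<delta> + \<epsilon>)"
proof -
  obtain \<phi> where \<phi>: "\<And>i. clinear_functional (\<phi> i)"
    "\<And>x. \<forall>i<k. \<phi> i x = 0 \<Longrightarrow> norm (S x) \<le> \<delta> * norm x"
    using assms(1) unfolding gelfand_le_def by blast
  obtain \<psi> where \<psi>: "\<And>i. clinear_functional (\<psi> i)"
    "\<And>x. \<forall>i<l. \<psi> i x = 0 \<Longrightarrow> norm (T x) \<le> \<epsilon> * norm x"
    using assms(2) unfolding gelfand_le_def by blast
  define \<theta> where "\<theta> i = (if i < k then \<phi> i else \<psi> (i - k))" for i
  have "norm (S x + T x) \<le> (\<delta> + \<epsilon>) * norm x" if x: "\<forall>i<k + l. \<theta> i x = 0" for x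
  proof -
    have "\<phi> i x = 0" if "i < k" for i using x[rule_format, of i] that by (simp add: \<theta>_def)
    moreover have "\<psi> i x = 0" if "i < l" for i
      using x[rule_format, of "k + i"] that by (simp add: \<theta>_def)
    ultimately have "norm (S x) + norm (T x) \<le> \<delta> * norm x + \<epsilon> * norm x"
      by (intro add_mono \<phi>(2) \<psi>(2)) auto
    then show ?thesis using norm_triangle_ineq[of "S x" "T x"] by (simp add: distrib_right)
  qed
  moreover have "clinear_functional (\<theta> i)" for i using \<phi>(1) \<psi>(1) by (simp add: \<theta>_def)
  ultimately show ?thesis unfolding gelfand_le_def by blast
qed

text \<open>The functionals are pulled back along \<open>B\<close>. The factor \<open>K\<close>
  comes from bounds for \<open>A\<close> and \<open>B\<close> alone and is uniform in
  \<open>k\<close> and \<open>\<delta>\<close>.\<close>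

lemma gelfand_le_compose:
  assumes A: "bounded_op A" and B: "bounded_op B"
  shows "\<exists>K\<ge>0. \<forall>k \<delta>. 0 \<le> \<delta> \<longrightarrow> gelfand_le T k \<delta> \<longrightarrow> gelfand_le (A \<circ> T \<circ> B) k (K * \<delta>)"
proof -
  obtain R where R: "0 < R" "\<And>x. norm (B x) \<le> norm x * R"
    using bounded_linear.pos_bounded[OF bounded_op_imp_bounded_linear[OF B]] by blast
  obtain Q where Q: "0 < Q" "\<And>x. norm (A x) \<le> norm x * Q"
    using bounded_linear.pos_bounded[OF bounded_op_imp_bounded_linear[OF A]] by blast
  have "gelfand_le (A \<circ> T \<circ> B) k (Q * R * \<delta>)" if "0 \<le> \<delta>" and T: "gelfand_le T k \<delta>" for k \<delta>
  proof -
    obtain \<phi> where \<phi>: "\<And>i. clinear_functional (\<phi> i)"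
      "\<And>x. \<forall>i<k. \<phi> i x = 0 \<Longrightarrow> norm (T x) \<le> \<delta> * norm x"
      using T unfolding gelfand_le_def by blast
    have "norm (A (T (B x))) \<le> Q * R * \<delta> * norm x" if "\<forall>i<k. \<phi> i (B x) = 0" for x
    proof -
      have "norm (A (T (B x))) \<le> norm (T (B x)) * Q" by (rule Q)
      also have "\<dots> \<le> \<delta> * norm (B x) * Q" using \<phi>(2)[OF that] Q(1) by simp
      also have "\<dots> \<le> \<delta> * (norm x * R) * Q"
        using R(2)[of x] Q(1) \<open>0 \<le> \<delta>\<close> by (intro mult_right_mono mult_left_mono) auto
      finally show ?thesis by (simp add: mult_ac)
    qed
    moreover have "clinear_functional (\<phi> i \<circ> B)" for i
      using \<phi>(1) B
      by (simp add: clinear_functional_def bounded_op_add bounded_op_scaleC)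
    ultimately show ?thesis
      unfolding gelfand_le_def by (intro exI[of _ "\<lambda>i. \<phi> i \<circ> B"]) simp
  qed
  then show ?thesis using R(1) Q(1) by (intro exI[of _ "Q * R"]) simp
qed

text \<open>An ideal defined by decay of Gelfand numbers. Once it contains
  \<open>diag_op e \<eta>\<close> it contains the whole principal ideal, which turns membership
  there into an estimate on sequences.\<close>

lemma operator_ideal_gelfand:
  assumes \<eta>: "\<eta> \<in> c0_star"
  shows "operator_ideal {T :: 'a::chilbert_space \<Rightarrow> 'a. compact_op T \<and>
           (\<exists>C m. 0 \<le> C \<and> 0 < m \<and> (\<forall>k. gelfand_le T k (C * \<eta> (k div m))))}"
    (is "operator_ideal ?G")
  unfolding operator_ideal_def
proof (intro conjI ballI allI impI)
  show "compact_op T" if "T \<in> ?G" for T using that by simp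
  show "(\<lambda>x. 0) \<in> ?G"
    using c0_starD(1)[OF \<eta>] by (auto intro!: compact_op_0 exI[of _ 0] exI[of _ 1] gelfand_le_0)
next
  fix S T :: "'a \<Rightarrow> 'a" assume S: "S \<in> ?G" and T: "T \<in> ?G"
  obtain C m where C: "0 \<le> C" "0 < m" "\<And>k. gelfand_le S k (C * \<eta> (k div m))" using S by blast
  obtain D n where D: "0 \<le> D" "0 < n" "\<And>k. gelfand_le T k (D * \<eta> (k div n))" using T by blast
  \<comment> \<open>Each summand receives half of the \<open>k\<close> functionals, whence the
    factor \<open>2\<close>; the product \<open>m * n\<close> dominates both \<open>m\<close> and
    \<open>n\<close>.\<close>
  have "gelfand_le (\<lambda>x. S x + T x) k ((C + D) * \<eta> (k div (2 * m * n)))" for k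
  proof (rule gelfand_le_mono[OF gelfand_le_plus[OF C(3)[of "k div 2"] D(3)[of "k div 2"]]])
    show "k div 2 + k div 2 \<le> k" by simp
    have "\<eta> (k div 2 div m) \<le> \<eta> (k div (2 * m * n))" "\<eta> (k div 2 div n) \<le> \<eta> (k div (2 * m * n))"
      using C(2) D(2) by (auto intro!: c0_starD(4)[OF \<eta>] div_le_mono2 simp: div_mult2_eq[symmetric])
    then show "C * \<eta> (k div 2 div m) + D * \<eta> (k div 2 div n) \<le> (C + D) * \<eta> (k div (2 * m * n))"
      unfolding distrib_right using C(1) D(1) by (intro add_mono mult_left_mono)
  qed
  moreover have "compact_op (\<lambda>x. S x + T x)" using S T by (simp add: compact_op_plus)
  moreover have "0 \<le> C + D" "0 < 2 * m * n" using C D by simp_all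
  ultimately show "(\<lambda>x. S x + T x) \<in> ?G" by blast
next
  fix T A B :: "'a \<Rightarrow> 'a" assume T: "T \<in> ?G" and A: "bounded_op A" and B: "bounded_op B"
  obtain C m where C: "0 \<le> C" "0 < m" "\<And>k. gelfand_le T k (C * \<eta> (k div m))" using T by blast
  have nn: "0 \<le> C * \<eta> k" for k using C(1) c0_starD(1)[OF \<eta>] by simp
  obtain K where K: "0 \<le> K" "\<And>k \<delta>. 0 \<le> \<delta> \<Longrightarrow> gelfand_le T k \<delta> \<Longrightarrow> gelfand_le (A \<circ> T \<circ> B) k (K * \<delta>)"
    using gelfand_le_compose[OF A B] by blast
  have "gelfand_le (A \<circ> T \<circ> B) k (K * C * \<eta> (k div m))" for k
    using K(2)[OF nn C(3)[of k]] by (simp add: mult.assoc)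
  moreover have "compact_op (A \<circ> T \<circ> B)" using T A B by (simp add: compact_op_compose)
  moreover have "0 \<le> K * C" using K(1) C(1) by simp
  ultimately show "A \<circ> T \<circ> B \<in> ?G" using C(2) by blast
qed

text \<open>The first \<open>k\<close> coordinate functionals are the witnesses: only weights from
  \<open>\<xi> k\<close> on remain.\<close>

lemma gelfand_le_diag_op:
  assumes e: "orthonormal e" and \<xi>: "\<xi> \<in> c0_star"
  shows "gelfand_le (diag_op e \<xi>) k (\<xi> k)"
proof -
  have "norm (diag_op e \<xi> x) \<le> \<xi> k * norm x" if x: "\<forall>i<k. cinner (e i) x = 0" for x
    unfolding diag_op_eq_diag_map
  proof (rule summable_norm_le_diag_map(2))
    show "\<bar>\<xi> n\<bar> * cmod (cinner (e n) x) \<le> \<xi> k * cmod (cinner (e n) x)" for n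
      using x c0_starD(1)[OF \<xi>, of n] c0_starD(4)[OF \<xi>, of k n]
      by (cases "n < k") (auto intro: mult_right_mono)
  qed (rule orthonormal_imp_suborthonormal[OF e] c0_starD(1)[OF \<xi>])+
  then show ?thesis
    unfolding gelfand_le_def
    by (intro exI[of _ "\<lambda>i. cinner (e i)"] conjI allI impI clinear_functional_cinner)
qed

text \<open>Gaussian elimination, by induction on the equations: a pivot in equation
  \<open>i\<close> removes one unknown together with that equation.\<close>

lemma homogeneous_system_nontrivial_solution:
  fixes A :: "'i \<Rightarrow> 'j \<Rightarrow> complex"
  assumes "finite I" "finite J" "card I < card J"
  shows "\<exists>c. (\<exists>j\<in>J. c j \<noteq> 0) \<and> (\<forall>i\<in>I. (\<Sum>j\<in>J. A i j * c j) = 0)"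
  using assms
proof (induction I arbitrary: A J rule: finite_induct)
  case empty
  then have "J \<noteq> {}" by auto
  then show ?case by (intro exI[of _ "\<lambda>_. 1"]) auto
next
  case (insert i I)
  show ?case
  proof (cases "\<forall>j\<in>J. A i j = 0")
    case True
    have "card I < card J" using insert.prems insert.hyps by simp
    from insert.IH[OF insert.prems(1) this, of A] obtain c
      where "\<exists>j\<in>J. c j \<noteq> 0" "\<forall>i\<in>I. (\<Sum>j\<in>J. A i j * c j) = 0" by blast
    with True show ?thesis by (intro exI[of _ c]) simp
  next
    case False
    then obtain p where p: "p \<in> J" "A i p \<noteq> 0" by blast
    have fin: "finite (J - {p})" using insert.prems by simp
    have "card I < card (J - {p})" using insert.prems insert.hyps p by simp
    from insert.IH[OF fin this, of "\<lambda>r j. A r j - A r p * A i j / A i p"] obtain c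
      where c: "\<exists>j\<in>J - {p}. c j \<noteq> 0"
        "\<And>r. r \<in> I \<Longrightarrow> (\<Sum>j\<in>J - {p}. (A r j - A r p * A i j / A i p) * c j) = 0" by blast
    define s where "s = (\<Sum>j\<in>J - {p}. A i j * c j)"
    \<comment> \<open>The pivot unknown is set to the value that solves equation
      \<open>i\<close>.\<close>
    define d where "d = c(p := - s / A i p)"
    have d: "(\<Sum>j\<in>J. A r j * d j) = A r p * (- s / A i p) + (\<Sum>j\<in>J - {p}. A r j * c j)" for r
    proof -
      have "(\<Sum>j\<in>J. A r j * d j) = A r p * d p + (\<Sum>j\<in>J - {p}. A r j * d j)"
        using insert.prems p by (intro sum.remove)
      also have "(\<Sum>j\<in>J - {p}. A r j * d j) = (\<Sum>j\<in>J - {p}. A r j * c j)"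
        by (intro sum.cong) (auto simp: d_def)
      finally show ?thesis by (simp add: d_def)
    qed
    have "(\<Sum>j\<in>J. A r j * d j) = 0" if "r \<in> insert i I" for r
    proof (cases "r = i")
      case True
      then show ?thesis using p by (simp add: d s_def[symmetric])
    next
      case False
      then have "r \<in> I" using that by blast
      then have "0 = (\<Sum>j\<in>J - {p}. (A r j - A r p * A i j / A i p) * c j)"
        by (rule c(2)[symmetric])
      also have "\<dots> = (\<Sum>j\<in>J - {p}. A r j * c j - A r p / A i p * (A i j * c j))"
        by (intro sum.cong refl) (simp add: left_diff_distrib mult.assoc)
      also have "\<dots> = (\<Sum>j\<in>J - {p}. A r j * c j) - A r p / A i p * s"
        by (simp add: sum_subtractf s_def sum_distrib_left)
      also have "\<dots> = A r p * (- s / A i p) + (\<Sum>j\<in>J - {p}. A r j * c j)" by simp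
      finally show ?thesis unfolding d by (rule sym)
    qed
    moreover have "\<exists>j\<in>J. d j \<noteq> 0" using c(1) by (auto simp: d_def)
    ultimately show ?thesis by blast
  qed
qed

text \<open>There are \<open>k\<close> equations for the \<open>k + 1\<close> coefficients of
  \<open>e 0\<close> to \<open>e k\<close>.\<close>

lemma exists_common_kernel_combination:
  fixes e :: "nat \<Rightarrow> 'a::complex_inner"
  assumes "\<And>i. clinear_functional (\<phi> i)"
  shows "\<exists>c. (\<exists>j\<le>k. c j \<noteq> 0) \<and> (\<forall>i<k. \<phi> i (\<Sum>j\<le>k. c j *\<^sub>C e j) = 0)"
proof -
  obtain c where c: "\<exists>j\<in>{..k}. c j \<noteq> 0" "\<And>i. i < k \<Longrightarrow> (\<Sum>j\<le>k. \<phi> i (e j) * c j) = 0"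
    using homogeneous_system_nontrivial_solution[of "{..<k}" "{..k}" "\<lambda>i j. \<phi> i (e j)"] by auto
  have add: "\<phi> i (x + y) = \<phi> i x + \<phi> i y" and scale: "\<phi> i (z *\<^sub>C x) = z * \<phi> i x" for i x y z
    using assms by (auto simp: clinear_functional_def)
  have "\<phi> i 0 = 0" for i using scale[of i 0 0] by (simp add: complex_vector.scale_zero_left)
  then have "\<phi> i (\<Sum>j\<in>J. c j *\<^sub>C e j) = (\<Sum>j\<in>J. \<phi> i (e j) * c j)" for i J
    by (induction J rule: infinite_finite_induct) (auto simp: add scale mult.commute)
  with c show ?thesis by (intro exI[of _ c]) auto
qed

text \<open>The span of \<open>e 0\<close> to \<open>e k\<close> has dimension \<open>k + 1\<close>,
  so it contains a nonzero vector killed by the \<open>k\<close> functionals; on this span the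
  operator stretches every norm by at least \<open>\<xi> k\<close>.\<close>

lemma le_of_gelfand_le_diag_op:
  assumes e: "orthonormal e" and \<xi>: "\<xi> \<in> c0_star" and "gelfand_le (diag_op e \<xi>) k \<delta>"
  shows "\<xi> k \<le> \<delta>"
proof -
  obtain \<phi> where \<phi>: "\<And>i. clinear_functional (\<phi> i)"
    "\<And>x. \<forall>i<k. \<phi> i x = 0 \<Longrightarrow> norm (diag_op e \<xi> x) \<le> \<delta> * norm x"
    using assms(3) unfolding gelfand_le_def by blast
  have "\<exists>c. (\<exists>j\<le>k. c j \<noteq> 0) \<and> (\<forall>i<k. \<phi> i (\<Sum>j\<le>k. c j *\<^sub>C e j) = 0)"
    using \<phi>(1) by (rule exists_common_kernel_combination)
  then obtain c j0 where c: "j0 \<le> k" "c j0 \<noteq> 0" "\<forall>i<k. \<phi> i (\<Sum>j\<le>k. c j *\<^sub>C e j) = 0"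
    by auto
  define x where "x = (\<Sum>j\<le>k. c j *\<^sub>C e j)"
  have norm_comb: "(norm (\<Sum>j\<le>k. z j *\<^sub>C e j))\<^sup>2 = (\<Sum>j\<le>k. (cmod (z j))\<^sup>2)" for z
    by (subst norm_sq_sum_orthogonal) (auto simp: orthonormalD[OF e])
  have "0 < (cmod (c j0))\<^sup>2" using c(2) by simp
  also have "\<dots> \<le> (\<Sum>j\<le>k. (cmod (c j))\<^sup>2)" using c(1) by (intro member_le_sum) auto
  also have "\<dots> = (norm x)\<^sup>2" by (simp add: x_def norm_comb)
  finally have "0 < norm x" by (simp add: zero_less_power2)
  have "(\<xi> k * norm x)\<^sup>2 = (\<Sum>j\<le>k. (\<xi> k)\<^sup>2 * (cmod (c j))\<^sup>2)"
    by (simp add: power_mult_distrib x_def norm_comb sum_distrib_left)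
  also have "\<dots> \<le> (\<Sum>j\<le>k. (cmod (c j * complex_of_real (\<xi> j)))\<^sup>2)"
  proof (rule sum_mono)
    fix j assume "j \<in> {..k}"
    then have "(\<xi> k)\<^sup>2 \<le> (\<xi> j)\<^sup>2" using c0_starD(1,4)[OF \<xi>] by (intro power_mono) auto
    from mult_right_mono[OF this, of "(cmod (c j))\<^sup>2"]
    show "(\<xi> k)\<^sup>2 * (cmod (c j))\<^sup>2 \<le> (cmod (c j * complex_of_real (\<xi> j)))\<^sup>2"
      by (simp add: norm_mult power_mult_distrib mult.commute)
  qed
  also have "\<dots> = (norm (diag_op e \<xi> x))\<^sup>2"
    unfolding x_def norm_comb[symmetric] diag_op_eq_diag_map
    by (subst diag_map_sum_apply[OF e]) (simp_all add: bounded_op_diag_op[OF e \<xi>] diag_op_eq_diag_map[symmetric])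
  finally have "\<xi> k * norm x \<le> norm (diag_op e \<xi> x)" by (rule power2_le_imp_le) simp
  also have "\<dots> \<le> \<delta> * norm x" using \<phi>(2) c(3) by (simp add: x_def)
  finally show ?thesis using \<open>0 < norm x\<close> by simp
qed

text \<open>Sufficiency is the factorization through residue classes. For necessity, compactness
  puts \<open>diag_op e \<eta>\<close> into the Gelfand ideal of \<open>\<eta>\<close>, where the
  Gelfand numbers of \<open>diag_op e \<xi>\<close> can be read off.\<close>

lemma principal_ideal_diag_op_subset_iff:
  assumes e: "orthonormal_basis e" and \<xi>: "\<xi> \<in> c0_star" and \<eta>: "\<eta> \<in> c0_star"
    and "compact_op (diag_op e \<eta>)"
  shows "principal_ideal (diag_op e \<xi>) \<subseteq> principal_ideal (diag_op e \<eta>) \<longleftrightarrow>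
           (\<exists>m>0. \<exists>C. \<forall>k. \<xi> k \<le> C * \<eta> (k div m))"
proof
  assume "\<exists>m>0. \<exists>C. \<forall>k. \<xi> k \<le> C * \<eta> (k div m)"
  then obtain m C where "0 < m" "\<And>k. \<xi> k \<le> C * \<eta> (k div m)" by blast
  then show "principal_ideal (diag_op e \<xi>) \<subseteq> principal_ideal (diag_op e \<eta>)"
    by (intro principal_ideal_mono diag_op_mem_ideal[OF e \<xi> \<eta>])
next
  note on = orthonormal_basis_imp_orthonormal[OF e]
  assume "principal_ideal (diag_op e \<xi>) \<subseteq> principal_ideal (diag_op e \<eta>)"
  then have "diag_op e \<xi> \<in> principal_ideal (diag_op e \<eta>)" using mem_principal_ideal by blast
  also have "\<dots> \<subseteq> {T. compact_op T \<and>
      (\<exists>C m. 0 \<le> C \<and> 0 < m \<and> (\<forall>k. gelfand_le T k (C * \<eta> (k div m))))}"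
    using assms(4) gelfand_le_diag_op[OF on \<eta>]
    by (intro principal_ideal_least operator_ideal_gelfand \<eta>)
      (auto intro!: exI[of _ 1])
  finally show "\<exists>m>0. \<exists>C. \<forall>k. \<xi> k \<le> C * \<eta> (k div m)"
    using le_of_gelfand_le_diag_op[OF on \<xi>] by blast
qed

subsection \<open>Singular value decomposition\<close>

lemma compact_op_convergent_subsequence:
  fixes X :: "'a::chilbert_space \<Rightarrow> 'a" and y :: "nat \<Rightarrow> 'a"
  assumes "compact_op X" "\<And>n. norm (y n) \<le> 1"
  obtains r z where "strict_mono r" "(\<lambda>n. X (y (r n))) \<longlonglongrightarrow> z"
proof -
  have "seq_compact (closure (X ` cball 0 1))"
    using assms(1) by (simp add: compact_op_def compact_imp_seq_compact)
  moreover have "\<forall>n. X (y n) \<in> closure (X ` cball 0 1)"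
    using assms(2) by (intro allI subsetD[OF closure_subset]) simp
  ultimately obtain z r where "z \<in> closure (X ` cball 0 1)" "strict_mono r"
    "((\<lambda>n. X (y n)) \<circ> r) \<longlonglongrightarrow> z"
    by (rule seq_compactE[of _ "\<lambda>n. X (y n)"])
  then show ?thesis using that by (simp add: o_def)
qed

text \<open>A maximizing sequence is Cauchy by the parallelogram law: \<open>norm (y m + y n)\<close> is nearly \<open>2\<close>
  because \<open>norm (X (y m) + X (y n))\<close> is nearly \<open>2 s\<close>.\<close>

lemma compact_op_attains_norm:
  fixes X :: "'a::chilbert_space \<Rightarrow> 'a"
  assumes X: "compact_op X" and V: "closed V" and sub: "complex_vector.subspace V"
    and v: "v \<in> V" "norm v = 1"
  shows "\<exists>u\<in>V. norm u = 1 \<and> (\<forall>y\<in>V. norm (X y) \<le> norm (X u) * norm y)"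
proof -
  have bX: "bounded_op X" using X by (rule compact_op_imp_bounded_op)
  interpret X: bounded_linear X using bX by (rule bounded_op_imp_bounded_linear)
  define U where "U = {y \<in> V. norm y = 1}"
  define s where "s = (SUP y\<in>U. norm (X y))"
  have U_ne: "U \<noteq> {}" using v by (auto simp: U_def)
  obtain R where R: "\<And>x. norm (X x) \<le> norm x * R" using X.bounded by blast
  have bdd: "bdd_above ((\<lambda>y. norm (X y)) ` U)"
    using R by (auto simp: bdd_above_def U_def intro!: exI[of _ R]) (metis mult_1)
  have le_s: "norm (X y) \<le> s * norm y" if "y \<in> V" for y
  proof (cases "y = 0")
    case False
    have "inverse (norm y) *\<^sub>R y \<in> U" 
      using False complex_vector.subspace_scale[OF sub that] by (simp add: U_def scaleR_scaleC norm_scaleC norm_inverse)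
    then have "norm (X (inverse (norm y) *\<^sub>R y)) \<le> s"
      unfolding s_def by (rule cSUP_upper[OF _ bdd])
    then show ?thesis using False by (simp add: X.scaleR field_simps)
  qed (simp add: X.zero)
  have "0 \<le> s" using order_trans[OF norm_ge_zero le_s[OF v(1)]] v(2) by simp
  show ?thesis
  proof (cases "s = 0")
    case True
    then have "norm (X y) \<le> norm (X v) * norm y" if "y \<in> V" for y
      using le_s[OF that] by simp
    with v show ?thesis by blast
  next
    case False
    with \<open>0 \<le> s\<close> have "0 < s" by simp
    have "\<exists>y\<in>U. s - inverse (real (Suc n)) < norm (X y)" for n
      using less_cSUP_iff[OF U_ne bdd, of "s - inverse (real (Suc n))"] by (simp add: s_def[symmetric])
    then obtain y where yU: "\<And>n. y n \<in> U" and y: "\<And>n. s - inverse (real (Suc n)) < norm (X (y n))"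
      by metis
    have yV: "y n \<in> V" and yn: "norm (y n) = 1" for n using yU[of n] by (auto simp: U_def)
    obtain r z where r: "strict_mono r" and z: "(\<lambda>n. X (y (r n))) \<longlonglongrightarrow> z"
      using compact_op_convergent_subsequence[OF X, of y] yn by auto
    have "(\<lambda>n. norm (X (y n))) \<longlonglongrightarrow> s"
    proof (rule tendsto_sandwich)
      show "(\<lambda>n. s - inverse (real (Suc n))) \<longlonglongrightarrow> s"
        using tendsto_diff[OF tendsto_const LIMSEQ_inverse_real_of_nat, of s] by simp
      show "\<forall>\<^sub>F n in sequentially. norm (X (y n)) \<le> s" using le_s[OF yV] yn by simp
    qed (auto intro!: always_eventually less_imp_le[OF y] simp del: of_nat_Suc)
    from LIMSEQ_subseq_LIMSEQ[OF this r] tendsto_norm[OF z] have nz: "norm z = s"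
      by (simp add: o_def LIMSEQ_unique)
    have "Cauchy (y \<circ> r)"
    proof (rule metric_CauchyI)
      fix \<epsilon> :: real assume "0 < \<epsilon>"
      \<comment> \<open>The first entry keeps \<open>2 * s - 2 * \<delta>\<close> nonnegative for
        squaring; the second makes the resulting bound \<open>8 * s * \<delta>\<close> at most
        \<open>s\<^sup>2 * \<epsilon>\<^sup>2 / 2\<close>.\<close>
      define \<delta> where "\<delta> = min s (s * \<epsilon>\<^sup>2 / 16)"
      have "0 < \<delta>" using \<open>0 < \<epsilon>\<close> \<open>0 < s\<close> by (simp add: \<delta>_def)
      then obtain N where N: "\<And>n. n \<ge> N \<Longrightarrow> norm (X (y (r n)) - z) < \<delta>"
        using z unfolding LIMSEQ_def dist_norm o_def by blast
      have "dist (y (r m)) (y (r n)) < \<epsilon>" if mn: "m \<ge> N" "n \<ge> N" for m n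
      proof -
        let ?a = "y (r m)" and ?b = "y (r n)"
        have "norm (2 *\<^sub>R z) \<le> norm (X ?a + X ?b) + norm ((z - X ?a) + (z - X ?b))"
          using norm_triangle_ineq[of "X ?a + X ?b" "(z - X ?a) + (z - X ?b)"]
          by (simp add: scaleR_2)
        moreover have "norm ((z - X ?a) + (z - X ?b)) \<le> 2 * \<delta>"
          using norm_triangle_ineq[of "z - X ?a" "z - X ?b"] N[OF mn(1)] N[OF mn(2)]
          by (simp add: norm_minus_commute)
        moreover have "norm (X ?a + X ?b) \<le> s * norm (?a + ?b)"
          using le_s[OF complex_vector.subspace_add[OF sub yV yV]] by (simp add: X.add)
        ultimately have "2 * s - 2 * \<delta> \<le> s * norm (?a + ?b)" using nz \<open>0 < s\<close> by simp
        then have "(2 * s - 2 * \<delta>)\<^sup>2 \<le> (s * norm (?a + ?b))\<^sup>2"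
          by (rule power_mono) (simp add: \<delta>_def)
        moreover have "(2 * s - 2 * \<delta>)\<^sup>2 = 4 * s\<^sup>2 - 8 * s * \<delta> + 4 * \<delta>\<^sup>2"
          by (simp add: power2_eq_square algebra_simps)
        ultimately have "4 * s\<^sup>2 - 8 * s * \<delta> \<le> s\<^sup>2 * (norm (?a + ?b))\<^sup>2"
          using zero_le_power2[of \<delta>] unfolding power_mult_distrib by linarith
        moreover have "(norm (?a + ?b))\<^sup>2 = 4 - (norm (?a - ?b))\<^sup>2"
          using parallelogram_law[of ?a ?b] yn by simp
        ultimately have "s\<^sup>2 * (norm (?a - ?b))\<^sup>2 \<le> 8 * s * \<delta>" by (simp add: algebra_simps)
        also have "\<dots> \<le> 8 * s * (s * \<epsilon>\<^sup>2 / 16)"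
          using \<open>0 < s\<close> by (intro mult_left_mono) (auto simp: \<delta>_def)
        also have "\<dots> = s\<^sup>2 * (\<epsilon>\<^sup>2 / 2)" by (simp add: power2_eq_square)
        finally have "(norm (?a - ?b))\<^sup>2 \<le> \<epsilon>\<^sup>2 / 2" using \<open>0 < s\<close> by simp
        also have "\<dots> < \<epsilon>\<^sup>2" using \<open>0 < \<epsilon>\<close> by simp
        finally have "(norm (?a - ?b))\<^sup>2 < \<epsilon>\<^sup>2" .
        then show ?thesis
          unfolding dist_norm by (rule power2_less_imp_less) (use \<open>0 < \<epsilon>\<close> in simp)
      qed
      then show "\<exists>N. \<forall>m\<ge>N. \<forall>n\<ge>N. dist ((y \<circ> r) m) ((y \<circ> r) n) < \<epsilon>" by auto
    qed
    then obtain u where u: "(y \<circ> r) \<longlonglongrightarrow> u" using Cauchy_convergent convergent_def by blast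
    have "u \<in> V" using closed_sequentially[OF V _ u] yV by simp
    moreover have "norm u = 1"
      using tendsto_norm[OF u] yn by (simp add: o_def LIMSEQ_const_iff)
    moreover have "norm (X u) = s"
      using LIMSEQ_unique[OF X.tendsto[OF u]] z nz by (simp add: o_def)
    ultimately show ?thesis using le_s by (intro bexI[of _ u]) auto
  qed
qed

text \<open>For small \<open>c\<close> of the right phase, the term of
  \<open>norm (p + c *\<^sub>C q)\<close> squared that is linear in \<open>c\<close> would outweigh
  the quadratic bound. The choice of \<open>t\<close> ensures \<open>K * t \<le> 1\<close> for
  either sign of \<open>K\<close>.\<close>

lemma cinner_eq_0_of_norm_add_sq_le:
  assumes "\<And>c. (norm (p + c *\<^sub>C (q::'a::complex_inner)))\<^sup>2 \<le> (norm p)\<^sup>2 + K * (cmod c)\<^sup>2"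
  shows "cinner p q = 0"
proof (rule ccontr)
  assume "cinner p q \<noteq> 0"
  define w where "w = (cmod (cinner p q))\<^sup>2"
  define t where "t = inverse (\<bar>K\<bar> + 1)"
  have "0 < w" using \<open>cinner p q \<noteq> 0\<close> by (simp add: w_def)
  have "0 < t" by (simp add: t_def)
  define c where "c = complex_of_real t * cnj (cinner p q)"
  have "cinner p (c *\<^sub>C q) = complex_of_real t * (cinner p q * cnj (cinner p q))"
    by (simp add: cinner_scaleC_right c_def)
  also have "\<dots> = complex_of_real (t * w)"
    unfolding w_def complex_norm_square[symmetric] by simp
  finally have "Re (cinner p (c *\<^sub>C q)) = t * w" by simp
  then have "2 * (t * w) \<le> K * (cmod c)\<^sup>2"
    using assms[of c] norm_add_sq[of p "c *\<^sub>C q"] zero_le_power2[of "norm (c *\<^sub>C q)"]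
    by linarith
  moreover have "(cmod c)\<^sup>2 = t\<^sup>2 * w"
    by (simp add: c_def norm_mult power_mult_distrib w_def)
  ultimately have "(t * w) * 2 \<le> (t * w) * (K * t)"
    by (simp add: power2_eq_square mult_ac)
  then have "2 \<le> K * t" using \<open>0 < t\<close> \<open>0 < w\<close> by (simp only: mult_le_cancel_left_pos mult_pos_pos)
  moreover have "K * t \<le> 1" by (simp add: t_def field_simps)
  ultimately show False by simp
qed

text \<open>The \<open>n\<close> conditions are imposed on the span of \<open>n + 1\<close>
  orthonormal vectors. This keeps the choice of singular vectors going indefinitely.\<close>

lemma exists_unit_vector_orthogonal:
  fixes e :: "nat \<Rightarrow> 'a::complex_inner"
  assumes e: "orthonormal e"
  shows "\<exists>v::'a. norm v = 1 \<and> (\<forall>i<(n::nat). cinner (f i) v = 0)"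
proof -
  have "\<exists>c. (\<exists>j\<le>n. c j \<noteq> 0) \<and> (\<forall>i<n. cinner (f i) (\<Sum>j\<le>n. c j *\<^sub>C e j) = 0)"
    by (rule exists_common_kernel_combination) (rule clinear_functional_cinner)
  then obtain c j where c: "j \<le> n" "c j \<noteq> 0" "\<forall>i<n. cinner (f i) (\<Sum>j\<le>n. c j *\<^sub>C e j) = 0"
    by auto
  define x where "x = (\<Sum>j\<le>n. c j *\<^sub>C e j)"
  have "cinner (e j) x = c j"
    using c(1) by (simp add: x_def cinner_sum_right cinner_scaleC_right orthonormalD[OF e] if_distrib cong: if_cong)
  then have "x \<noteq> 0" using c(2) by auto
  then show ?thesis
    using c(3) by (intro exI[of _ "inverse (norm x) *\<^sub>R x"]) (auto simp: x_def[symmetric] cinner_scaleR_right)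
qed

text \<open>The \<open>f n\<close> are chosen successively as unit vectors maximizing
  \<open>norm (X y)\<close> orthogonally to the earlier ones. Maximality makes their images
  orthogonal, compactness forces \<open>s\<close> to tend to \<open>0\<close>, and hence
  \<open>X\<close> vanishes on the orthogonal complement of all \<open>f n\<close>.\<close>

lemma singular_value_decomposition:
  fixes X :: "'a::chilbert_space \<Rightarrow> 'a" and e :: "nat \<Rightarrow> 'a"
  assumes X: "compact_op X" and e: "orthonormal e"
  obtains f g :: "nat \<Rightarrow> 'a" and s where "orthonormal f" "suborthonormal g" "s \<in> c0_star"
    "\<And>n. s n \<noteq> 0 \<Longrightarrow> norm (g n) = 1" "X = diag_map f s g"
proof -
  have bX: "bounded_op X" using X by (rule compact_op_imp_bounded_op)
  interpret X: bounded_linear X using bX by (rule bounded_op_imp_bounded_linear)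
  define P where "P f n u \<longleftrightarrow> norm u = 1 \<and> (\<forall>i<n. cinner (f i) u = 0) \<and>
      (\<forall>y. (\<forall>i<n. cinner (f i) y = 0) \<longrightarrow> norm (X y) \<le> norm (X u) * norm y)"
    for f :: "nat \<Rightarrow> 'a" and n u
  have "\<exists>f. \<forall>n. P f n (f n)"
  proof (rule dependent_wellorder_choice)
    show "P f n r = P g n r" if "\<And>y. y < n \<Longrightarrow> f y = g y" for r f g n
      using that by (auto simp: P_def)
  next
    fix n :: nat and f :: "nat \<Rightarrow> 'a"
    define V where "V = {y. \<forall>i<n. cinner (f i) y = 0}"
    have "V = (\<Inter>i<n. {y. cinner (f i) y = 0})" by (auto simp: V_def)
    moreover have "closed (\<Inter>i<n. {y. cinner (f i) y = 0})"
      by (intro closed_INT ballI closed_Collect_eq linear_continuous_on bounded_linear_cinner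
          continuous_on_const)
    ultimately have "closed V" by simp
    moreover have "complex_vector.subspace V"
      by (auto simp: complex_vector.subspace_def V_def cinner_add_right cinner_scaleC_right)
    moreover obtain v where "v \<in> V" "norm v = 1"
      using exists_unit_vector_orthogonal[OF e, of n f] by (auto simp: V_def)
    ultimately have "\<exists>u\<in>V. norm u = 1 \<and> (\<forall>y\<in>V. norm (X y) \<le> norm (X u) * norm y)"
      by (rule compact_op_attains_norm[OF X])
    then show "\<exists>u. P f n u" by (auto simp: P_def V_def)
  qed
  then obtain f where f: "\<And>n. P f n (f n)" by blast
  define s where "s n = norm (X (f n))" for n
  \<comment> \<open>Where \<open>s n = 0\<close> the convention \<open>inverse 0 = 0\<close> gives
    \<open>g n = 0\<close>, so \<open>g\<close> is only suborthonormal.\<close>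
  define g where "g n = inverse (s n) *\<^sub>R X (f n)" for n
  have fn: "norm (f n) = 1" for n using f[of n] by (simp add: P_def)
  have f0: "cinner (f i) (f n) = 0" if "i < n" for i n using f[of n] that by (simp add: P_def)
  have norm_X_le: "norm (X y) \<le> s n * norm y" if "\<And>i. i < n \<Longrightarrow> cinner (f i) y = 0" for n y
    using f[of n] that by (simp add: P_def s_def)
  have f_on: "orthonormal f"
    unfolding orthonormal_def
  proof (intro allI)
    fix i j :: nat
    consider "i < j" | "i = j" | "j < i" by linarith
    then show "cinner (f i) (f j) = (if i = j then 1 else 0)"
      by cases (use f0 in \<open>auto simp: cinner_self fn cinner_eq_0_commute[of "f i" "f j"]\<close>)
  qed
  \<comment> \<open>First variation at a maximizer: \<open>f m + c *\<^sub>C f n\<close> is still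
    orthogonal to the vectors before \<open>f m\<close>, and its squared norm exceeds
    \<open>1\<close> only by a term quadratic in \<open>c\<close>.\<close>
  have "cinner (X (f m)) (X (f n)) = 0" if "m < n" for m n
  proof (rule cinner_eq_0_of_norm_add_sq_le)
    fix c
    have "norm (X (f m + c *\<^sub>C f n)) \<le> s m * norm (f m + c *\<^sub>C f n)"
      using that by (intro norm_X_le) (simp add: cinner_add_right cinner_scaleC_right f0)
    from power_mono[OF this, of 2]
    have "(norm (X (f m) + c *\<^sub>C X (f n)))\<^sup>2 \<le> (s m)\<^sup>2 * (norm (f m + c *\<^sub>C f n))\<^sup>2"
      by (simp add: X.add bounded_op_scaleC[OF bX] power_mult_distrib)
    also have "(norm (f m + c *\<^sub>C f n))\<^sup>2 = 1 + (cmod c)\<^sup>2"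
      using that by (simp add: norm_add_sq cinner_scaleC_right f0 fn norm_scaleC)
    finally show "(norm (X (f m) + c *\<^sub>C X (f n)))\<^sup>2 \<le> (norm (X (f m)))\<^sup>2 + (s m)\<^sup>2 * (cmod c)\<^sup>2"
      by (simp add: distrib_left s_def)
  qed
  then have X_orth: "cinner (X (f m)) (X (f n)) = 0" if "m \<noteq> n" for m n
    using that cinner_eq_0_commute[of "X (f m)" "X (f n)"] by (meson nat_neq_iff)
  have "inverse (norm x) * norm x \<le> 1" for x :: 'a by (cases "x = 0") auto
  then have g: "suborthonormal g"
    by (auto simp: suborthonormal_def g_def cinner_scaleR_left cinner_scaleR_right X_orth s_def)
  have g1: "norm (g n) = 1" if "s n \<noteq> 0" for n using that by (simp add: g_def s_def)
  have Xf: "X (f n) = complex_of_real (s n) *\<^sub>C g n" for n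
    unfolding scaleR_scaleC[symmetric] g_def by (cases "s n = 0") (simp_all add: s_def)
  have s_dec: "decseq s"
    unfolding decseq_Suc_iff using norm_X_le[of n "f (Suc n)" for n] fn f0
    by (metis less_SucI mult.right_neutral s_def)
  \<comment> \<open>Otherwise the images \<open>X (f n)\<close> would be orthogonal with norms at
    least \<open>\<epsilon>\<close>, and no subsequence of them could be Cauchy.\<close>
  have s_small: "\<exists>n. s n < \<epsilon>" if eps: "0 < \<epsilon>" for \<epsilon>
  proof (rule ccontr)
    assume "\<not> ?thesis"
    then have ge: "\<epsilon> \<le> s n" for n by (simp add: not_less)
    obtain r z where r: "strict_mono r" and z: "(\<lambda>n. X (f (r n))) \<longlonglongrightarrow> z"
      using compact_op_convergent_subsequence[OF X, of f] fn by auto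
    obtain N where N: "\<And>m n. m \<ge> N \<Longrightarrow> n \<ge> N \<Longrightarrow> dist (X (f (r m))) (X (f (r n))) < \<epsilon>"
      using metric_CauchyD[OF LIMSEQ_imp_Cauchy[OF z] eps] by (auto simp: o_def)
    have "r N \<noteq> r (Suc N)" using strict_monoD[OF r, of N "Suc N"] by simp
    then have "(s (r N))\<^sup>2 \<le> (norm (X (f (r N)) - X (f (r (Suc N)))))\<^sup>2"
      by (simp add: norm_diff_sq X_orth s_def)
    then have "s (r N) \<le> dist (X (f (r N))) (X (f (r (Suc N))))"
      unfolding dist_norm by (rule power2_le_imp_le) simp
    then show False using N[of N "Suc N"] ge[of "r N"] by simp
  qed
  have s_c0: "s \<in> c0_star"
  proof -
    have "s \<longlonglongrightarrow> 0"
    proof (rule LIMSEQ_I)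
      fix \<epsilon> :: real assume "0 < \<epsilon>"
      then obtain N where "s N < \<epsilon>" using s_small by blast
      then have "norm (s n - 0) < \<epsilon>" if "n \<ge> N" for n
        using decseqD[OF s_dec that] by (simp add: s_def)
      then show "\<exists>N. \<forall>n\<ge>N. norm (s n - 0) < \<epsilon>" by blast
    qed
    then show ?thesis using s_dec by (simp add: c0_star_def s_def)
  qed
  have "X x = diag_map f s g x" for x
  proof -
    \<comment> \<open>\<open>p\<close> is the projection of \<open>x\<close> onto the closed span of
      \<open>f\<close>. The remainder \<open>q\<close> is orthogonal to every \<open>f n\<close>, so
      \<open>norm (X q) \<le> s n * norm q\<close> for every \<open>n\<close>.\<close>
    define p where "p = diag_map f (\<lambda>_. 1) f x"
    define q where "q = x - p"
    have "cinner (f n) p = cinner (f n) x" for n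
      unfolding p_def
      by (subst cinner_diag_map[where K = 1]) (simp_all add: f_on orthonormal_imp_suborthonormal)
    then have q: "cinner (f n) q = 0" for n by (simp add: q_def cinner_diff_right)
    have "norm (X q) \<le> 0"
    proof (rule field_le_epsilon)
      fix \<epsilon> :: real assume "0 < \<epsilon>"
      \<comment> \<open>The summand \<open>1\<close> avoids division by zero when
        \<open>q = 0\<close>.\<close>
      then have "0 < \<epsilon> / (norm q + 1)" by (simp add: add_nonneg_pos)
      then obtain n where n: "s n < \<epsilon> / (norm q + 1)" using s_small by blast
      have "norm (X q) \<le> s n * norm q" by (rule norm_X_le) (rule q)
      also have "\<dots> \<le> s n * (norm q + 1)" by (intro mult_left_mono) (simp_all add: s_def)
      also have "\<dots> \<le> \<epsilon>" using n by (simp add: less_divide_eq add_nonneg_pos less_imp_le)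
      finally show "norm (X q) \<le> 0 + \<epsilon>" by simp
    qed
    then have "X q = 0" by simp
    have sm: "summable (\<lambda>n. (complex_of_real 1 * cinner (f n) x) *\<^sub>C f n)"
      using f_on
      by (intro summable_norm_le_diag_map(1)[where K = 1 and c = "\<lambda>_. 1"] orthonormal_imp_suborthonormal) auto
    have "X x = X p + X q" by (simp add: q_def X.diff)
    also have "\<dots> = X p" using \<open>X q = 0\<close> by simp
    also have "\<dots> = (\<Sum>n. X ((complex_of_real 1 * cinner (f n) x) *\<^sub>C f n))"
      unfolding p_def diag_map_def by (rule X.suminf[OF sm])
    also have "\<dots> = diag_map f s g x"
      by (simp add: diag_map_def bounded_op_scaleC[OF bX] Xf scaleC_scaleC mult.commute)
    finally show ?thesis .
  qed
  then have "X = diag_map f s g" by blast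
  with that f_on g s_c0 g1 show ?thesis by blast
qed

text \<open>The singular value decomposition yields factorizations in both directions,
  \<open>X = A \<circ> diag_op e s \<circ> B\<close> and
  \<open>diag_op e s = W \<circ> X \<circ> U\<close>.\<close>

lemma principal_ideal_eq_diag_op:
  fixes e :: "nat \<Rightarrow> 'a::chilbert_space"
  assumes X: "compact_op X" and e: "orthonormal_basis e"
  obtains s where "s \<in> c0_star" "principal_ideal X = principal_ideal (diag_op e s)"
proof -
  note on = orthonormal_basis_imp_orthonormal[OF e]
  note so = orthonormal_imp_suborthonormal
  obtain f g s where f: "orthonormal f" and g: "suborthonormal g" and s: "s \<in> c0_star"
    and g1: "\<And>n. s n \<noteq> 0 \<Longrightarrow> norm (g n) = 1" and Xd: "X = diag_map f s g"
    using singular_value_decomposition[OF X on] by blast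
  have bop: "bounded_op (diag_map a (\<lambda>_. 1) b)" if "suborthonormal a" "suborthonormal b"
    for a b :: "nat \<Rightarrow> 'a"
    using that by (intro bounded_op_diag_map[where K = 1]) simp_all
  define A where "A = diag_map e (\<lambda>_. 1) g"
  define B where "B = diag_map f (\<lambda>_. 1) e"
  define U where "U = diag_map e (\<lambda>_. 1) f"
  define W where "W = diag_map g (\<lambda>_. 1) e"
  have bd: "bounded_op A" "bounded_op B" "bounded_op U" "bounded_op W"
    unfolding A_def B_def U_def W_def by (intro bop so on f g)+
  have "X = A \<circ> diag_op e s \<circ> B"
  proof
    fix x
    have "cinner (e n) (diag_op e s (B x)) = complex_of_real (s n) * cinner (f n) x" for n
    proof -
      have "cinner (e n) (diag_op e s (B x)) = complex_of_real (s n) * cinner (e n) (B x)"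
        unfolding diag_op_eq_diag_map by (rule cinner_diag_map[OF so[OF on] on c0_starD(5)[OF s]])
      also have "cinner (e n) (B x) = cinner (f n) x"
        unfolding B_def by (subst cinner_diag_map[OF so[OF f] on, where K = 1]) simp_all
      finally show ?thesis .
    qed
    then show "X x = (A \<circ> diag_op e s \<circ> B) x"
      by (simp add: Xd A_def diag_map_def)
  qed
  moreover have "diag_op e s = W \<circ> X \<circ> U"
  proof (rule bounded_op_eqI[OF e bounded_op_diag_op[OF on s]])
    show "bounded_op (W \<circ> X \<circ> U)"
      by (intro bounded_op_compose bd compact_op_imp_bounded_op[OF X])
    fix n
    \<comment> \<open>The scalar is \<open>1\<close> where \<open>s n \<noteq> 0\<close>; elsewhere
      \<open>X (f n) = 0\<close> and its value is immaterial.\<close>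
    have "W (g n) = complex_of_real ((norm (g n))\<^sup>2) *\<^sub>C e n"
      unfolding W_def
      by (subst diag_map_single[of n]) (use suborthonormalD(1)[OF g] in \<open>auto simp: cinner_self\<close>)
    moreover have "U (e n) = f n"
      by (simp add: U_def diag_map_apply[OF on] scaleC_one)
    moreover have "X (f n) = complex_of_real (s n) *\<^sub>C g n"
      by (simp add: Xd diag_map_apply[OF f])
    ultimately show "diag_op e s (e n) = (W \<circ> X \<circ> U) (e n)"
      using g1[of n] bd(4)
      by (cases "s n = 0") (simp_all add: diag_op_apply[OF on] bounded_op_scaleC bounded_op_zero scaleC_scaleC
          complex_vector.scale_zero_left)
  qed
  ultimately have "principal_ideal X = principal_ideal (diag_op e s)"
    using bd by (metis operator_idealD(4) principal_ideal_mono subset_antisym)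
  with s that show ?thesis by blast
qed

subsection \<open>Density\<close>

text \<open>Iterating the doubling estimate \<open>m\<close> times handles the ampliation by
  \<open>2 ^ m\<close>, which dominates the one by \<open>m\<close>.\<close>

lemma Delta_half_imp_bigo_div:
  assumes "Delta_half \<xi>" and \<xi>: "\<xi> \<in> c0_star" and m: "0 < m"
  obtains C where "0 \<le> C" "\<And>k. \<xi> (k div m) \<le> C * \<xi> k"
proof -
  obtain M where M: "\<And>k. \<xi> (k div 2) \<le> M * \<xi> k"
    using assms(1) by (auto simp: Delta_half_def ampliation_def)
  have M': "\<xi> (k div 2) \<le> \<bar>M\<bar> * \<xi> k" for k
    using order_trans[OF M mult_right_mono[OF abs_ge_self c0_starD(1)[OF \<xi>]]] .
  have pow: "\<xi> (k div 2 ^ i) \<le> \<bar>M\<bar> ^ i * \<xi> k" for i k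
  proof (induction i arbitrary: k)
    case (Suc i)
    have "\<xi> (k div 2 ^ Suc i) \<le> \<bar>M\<bar> ^ i * \<xi> (k div 2)"
      using Suc[of "k div 2"] by (simp add: div_mult2_eq)
    also have "\<dots> \<le> \<bar>M\<bar> ^ i * (\<bar>M\<bar> * \<xi> k)" by (intro mult_left_mono M') simp
    finally show ?case by (simp add: mult_ac)
  qed simp
  have "\<xi> (k div m) \<le> \<bar>M\<bar> ^ m * \<xi> k" for k
  proof -
    have "k div 2 ^ m \<le> k div m" by (intro div_le_mono2) (use m in \<open>auto intro: less_imp_le\<close>)
    then have "\<xi> (k div m) \<le> \<xi> (k div 2 ^ m)" by (rule c0_starD(4)[OF \<xi>])
    with pow[of k m] show ?thesis by linarith
  qed
  then show ?thesis by (intro that[of "\<bar>M\<bar> ^ m"]) auto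
qed

lemma c0_star_ampliation:
  assumes "\<xi> \<in> c0_star" "0 < m" "0 \<le> C"
  shows "(\<lambda>k. C * \<xi> (k div m)) \<in> c0_star"
proof -
  have "filterlim (\<lambda>k. k div m) at_top sequentially"
    unfolding filterlim_at_top eventually_sequentially
    using assms(2) by (metis div_le_mono nonzero_mult_div_cancel_left not_gr_zero)
  then have "(\<lambda>k. C * \<xi> (k div m)) \<longlonglongrightarrow> 0"
    by (intro tendsto_mult_right_zero filterlim_compose[OF c0_starD(3)[OF assms(1)]])
  moreover have "decseq (\<lambda>k. C * \<xi> (k div m))"
    using assms(3) unfolding decseq_def
    by (intro allI impI mult_left_mono c0_starD(4)[OF assms(1)] div_le_mono)
  ultimately show ?thesis using assms(3) c0_starD(1)[OF assms(1)] by (simp add: c0_star_def)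
qed

text \<open>As the estimate holds at all indices, a zero at \<open>k\<close> would propagate to
  \<open>k div 2\<close> and finally to \<open>0\<close>.\<close>

lemma Delta_half_pos:
  assumes "Delta_half \<xi>" "\<xi> \<in> c0_star" "\<xi> 0 \<noteq> 0"
  shows "0 < \<xi> k"
proof (induction k rule: less_induct)
  case (less k)
  show ?case
  proof (cases "k = 0")
    case True
    then show ?thesis using assms(3) c0_starD(1)[OF assms(2), of 0] by simp
  next
    case False
    then have "0 < \<xi> (k div 2)" using less by simp
    moreover obtain M where "\<xi> (k div 2) \<le> M * \<xi> k"
      using assms(1) by (auto simp: Delta_half_def ampliation_def)
    ultimately show ?thesis using c0_starD(1)[OF assms(2), of k] by (cases "\<xi> k = 0") auto
  qed
qed

lemma PL_E:
  fixes e :: "nat \<Rightarrow> 'a::chilbert_space"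
  assumes "J \<in> PL" "orthonormal_basis e"
  obtains \<eta> where "\<eta> \<in> c0_star" "J = principal_ideal (diag_op e \<eta>)" "compact_op (diag_op e \<eta>)"
proof -
  obtain X where X: "compact_op X" "J = principal_ideal X" using assms(1) by (auto simp: PL_def)
  obtain \<eta> where \<eta>: "\<eta> \<in> c0_star" "principal_ideal X = principal_ideal (diag_op e \<eta>)"
    using principal_ideal_eq_diag_op[OF X(1) assms(2)] .
  then have "compact_op (diag_op e \<eta>)"
    using compact_op_of_mem_principal_ideal[OF X(1)] mem_principal_ideal by auto
  with \<eta> X(2) show ?thesis using that by simp
qed

lemma Delta_half_PL_E:
  fixes e :: "nat \<Rightarrow> 'a::chilbert_space"
  assumes "I \<in> Delta_half_PL e"
  obtains \<xi> M where "I = principal_ideal (diag_op e \<xi>)" "compact_op (diag_op e \<xi>)" "Delta_half \<xi>"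
    "doubling_sequence \<xi> M"
proof -
  obtain \<xi> where \<xi>: "\<xi> \<in> c0_star" "Delta_half \<xi>" "I = principal_ideal (diag_op e \<xi>)" and I: "I \<in> PL"
    using assms by (auto simp: Delta_half_PL_def)
  obtain X where X: "compact_op X" "I = principal_ideal X" using I by (auto simp: PL_def)
  have "compact_op (diag_op e \<xi>)"
    using compact_op_of_mem_principal_ideal[OF X(1)] mem_principal_ideal[of "diag_op e \<xi>"] X(2) \<xi>(3)
    by simp
  moreover have "\<xi> 0 \<noteq> 0"
  proof
    assume "\<xi> 0 = 0"
    then have "\<xi> k = 0" for k using c0_starD(1,5)[OF \<xi>(1), of k] by simp
    then have "diag_op e \<xi> = (\<lambda>x. 0)" by (simp add: fun_eq_iff diag_op_def complex_vector.scale_zero_left)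
    then have "I = {\<lambda>x. 0}"
      using \<xi>(3) principal_ideal_least[OF operator_ideal_zero, of "\<lambda>x. 0"]
        mem_principal_ideal[of "\<lambda>x::'a. 0"] by auto
    then show False using I by (simp add: PL_def)
  qed
  moreover obtain M where M: "\<And>k. \<xi> (k div 2) \<le> M * \<xi> k"
    using \<xi>(2) by (auto simp: Delta_half_def ampliation_def)
  have "\<xi> (k div 2) \<le> max 1 M * \<xi> k" for k
    using order_trans[OF M mult_right_mono[OF max.cobounded2 c0_starD(1)[OF \<xi>(1)]]] .
  ultimately have "doubling_sequence \<xi> (max 1 M)"
    using \<xi> Delta_half_pos[OF \<xi>(2,1)] by unfold_locales auto
  then show ?thesis using that \<xi> \<open>compact_op (diag_op e \<xi>)\<close> by blast
qed

lemma Delta_half_PL_I: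
  fixes e :: "nat \<Rightarrow> 'a::chilbert_space"
  assumes e: "orthonormal_basis e" and "\<zeta> \<in> c0_star" "Delta_half \<zeta>" "0 < \<zeta> 0"
    and "compact_op (diag_op e \<zeta>)"
  shows "principal_ideal (diag_op e \<zeta>) \<in> Delta_half_PL e"
proof -
  note on = orthonormal_basis_imp_orthonormal[OF e]
  have "norm (diag_op e \<zeta> (e 0)) = \<zeta> 0"
    using assms(4) by (simp add: diag_op_apply[OF on] norm_scaleC orthonormalD(2)[OF on])
  then have "diag_op e \<zeta> \<noteq> (\<lambda>x. 0)" using assms(4) by auto
  then have "principal_ideal (diag_op e \<zeta>) \<noteq> {\<lambda>x. 0}" using mem_principal_ideal by blast
  then show ?thesis using assms by (auto simp: Delta_half_PL_def PL_def)
qed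

text \<open>The doubling condition on the larger sequence absorbs the ampliation.\<close>

lemma principal_ideal_diag_op_subset_iff_bigo:
  assumes e: "orthonormal_basis e" and \<xi>: "\<xi> \<in> c0_star" and \<eta>: "\<eta> \<in> c0_star" "Delta_half \<eta>"
    and "compact_op (diag_op e \<eta>)"
  shows "principal_ideal (diag_op e \<xi>) \<subseteq> principal_ideal (diag_op e \<eta>) \<longleftrightarrow>
           (\<exists>C\<ge>0. \<forall>k. \<xi> k \<le> C * \<eta> k)"
  unfolding principal_ideal_diag_op_subset_iff[OF e \<xi> \<eta>(1) assms(5)]
proof
  assume "\<exists>C\<ge>0. \<forall>k. \<xi> k \<le> C * \<eta> k"
  then obtain C where "\<And>k. \<xi> k \<le> C * \<eta> k" by blast
  then show "\<exists>m>0. \<exists>C. \<forall>k. \<xi> k \<le> C * \<eta> (k div m)"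
    by (intro exI[of _ 1] conjI exI[of _ C]) simp_all
next
  assume "\<exists>m>0. \<exists>C. \<forall>k. \<xi> k \<le> C * \<eta> (k div m)"
  then obtain m C where C: "0 < m" "\<And>k. \<xi> k \<le> C * \<eta> (k div m)" by blast
  obtain D where D: "0 \<le> D" "\<And>k. \<eta> (k div m) \<le> D * \<eta> k"
    using Delta_half_imp_bigo_div[OF \<eta>(2,1) C(1)] by blast
  have "\<xi> k \<le> (\<bar>C\<bar> * D) * \<eta> k" for k
  proof -
    have "\<xi> k \<le> \<bar>C\<bar> * \<eta> (k div m)"
      using order_trans[OF C(2) mult_right_mono[OF abs_ge_self c0_starD(1)[OF \<eta>(1)]]] .
    also have "\<dots> \<le> \<bar>C\<bar> * (D * \<eta> k)" by (intro mult_left_mono D) simp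
    finally show ?thesis by (simp add: mult.assoc)
  qed
  then show "\<exists>C\<ge>0. \<forall>k. \<xi> k \<le> C * \<eta> k" using D(1) by (intro exI[of _ "\<bar>C\<bar> * D"]) auto
qed

lemma Delta_half_PL_upper_dense:
  fixes e :: "nat \<Rightarrow> 'a::chilbert_space"
  assumes e: "orthonormal_basis e" and I: "I \<in> Delta_half_PL e" and J: "J \<in> PL" and "I \<subset> J"
  shows "\<exists>L\<in>Delta_half_PL e. I \<subset> L \<and> L \<subset> J"
proof -
  obtain \<xi> M where I_eq: "I = principal_ideal (diag_op e \<xi>)" and cI: "compact_op (diag_op e \<xi>)"
    and dI: "Delta_half \<xi>" and "doubling_sequence \<xi> M"
    using Delta_half_PL_E[OF I] .
  then interpret doubling_sequence \<xi> M by blast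
  obtain \<eta> where \<eta>: "\<eta> \<in> c0_star" and J_eq: "J = principal_ideal (diag_op e \<eta>)"
    and cJ: "compact_op (diag_op e \<eta>)"
    using PL_E[OF J e] .
  note J_iff = principal_ideal_diag_op_subset_iff[OF e _ \<eta> cJ]
  obtain m C0 where m: "0 < m" and C0: "\<And>k. \<xi> k \<le> C0 * \<eta> (k div m)"
    using \<open>I \<subset> J\<close> unfolding I_eq J_eq psubset_eq J_iff[OF c0] by blast
  define C where "C = max C0 1"
  have "1 \<le> C" by (simp add: C_def)
  \<comment> \<open>A multiple of an ampliation of \<open>\<eta>\<close> lies pointwise above
    \<open>\<xi>\<close>, as the construction demands; \<open>1 \<le> C\<close> keeps it above
    \<open>\<eta>\<close> as well.\<close>
  define \<eta>' where "\<eta>' k = C * \<eta> (k div m)" for k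
  have "\<eta>' \<in> c0_star"
    unfolding \<eta>'_def using \<open>1 \<le> C\<close> by (intro c0_star_ampliation \<eta> m) simp
  moreover have "\<xi> k \<le> \<eta>' k" for k
    using order_trans[OF C0 mult_right_mono[OF max.cobounded1 c0_starD(1)[OF \<eta>]], of _ 1]
    by (simp add: \<eta>'_def C_def)
  moreover have \<eta>_le: "\<eta> k \<le> \<eta>' k" for k
  proof -
    have "\<eta> k \<le> 1 * \<eta> (k div m)" using c0_starD(4)[OF \<eta>, of "k div m" k] by simp
    also have "\<dots> \<le> \<eta>' k"
      unfolding \<eta>'_def using \<open>1 \<le> C\<close> c0_starD(1)[OF \<eta>] by (intro mult_right_mono)
    finally show ?thesis .
  qed
  moreover have "\<nexists>D. \<forall>k. \<eta>' k \<le> D * \<xi> k"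
  proof
    assume "\<exists>D. \<forall>k. \<eta>' k \<le> D * \<xi> k"
    then obtain D where "\<And>k. \<eta> k \<le> D * \<xi> (k div 1)"
      using \<eta>_le by (metis div_by_1 order_trans)
    then have "J \<subseteq> I"
      unfolding I_eq J_eq principal_ideal_diag_op_subset_iff[OF e \<eta> c0 cI] by blast
    with \<open>I \<subset> J\<close> show False by blast
  qed
  ultimately obtain \<zeta> where \<zeta>: "\<zeta> \<in> c0_star" "Delta_half \<zeta>" and ge: "\<And>k. \<xi> k \<le> \<zeta> k"
    and le: "\<And>k. \<zeta> k \<le> \<eta>' k" and not_xi: "\<nexists>C. \<forall>k. \<zeta> k \<le> C * \<xi> k"
    and not_eta: "\<nexists>C. \<forall>k. \<eta>' k \<le> C * \<zeta> k"
    using exists_sequence_above[of \<eta>'] by blast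
  define L where "L = principal_ideal (diag_op e \<zeta>)"
  have "L \<subseteq> J"
    unfolding L_def J_eq J_iff[OF \<zeta>(1)] using m le unfolding \<eta>'_def by blast
  then have cL: "compact_op (diag_op e \<zeta>)"
    using compact_op_of_mem_principal_ideal[OF cJ] mem_principal_ideal unfolding L_def J_eq by blast
  note L_iff = principal_ideal_diag_op_subset_iff_bigo[OF e _ \<zeta> cL]
  have "L \<in> Delta_half_PL e"
    unfolding L_def using order_less_le_trans[OF pos ge] by (intro Delta_half_PL_I e \<zeta> cL)
  moreover have "I \<subseteq> L" unfolding I_eq L_def L_iff[OF c0] using ge by (intro exI[of _ 1]) simp
  moreover have "\<not> L \<subseteq> I"
    unfolding I_eq L_def principal_ideal_diag_op_subset_iff_bigo[OF e \<zeta>(1) c0 dI cI]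
    using not_xi by blast
  moreover have "\<not> J \<subseteq> L"
  proof
    assume "J \<subseteq> L"
    then obtain D where D: "0 \<le> D" "\<And>k. \<eta> k \<le> D * \<zeta> k" unfolding J_eq L_def L_iff[OF \<eta>] by blast
    \<comment> \<open>\<open>\<zeta>\<close> absorbs the ampliation by \<open>m\<close>, so a bound
      of \<open>\<eta>\<close> by \<open>\<zeta>\<close> lifts to one of
      \<open>\<eta>'\<close>.\<close>
    obtain E where E: "0 \<le> E" "\<And>k. \<zeta> (k div m) \<le> E * \<zeta> k"
      using Delta_half_imp_bigo_div[OF \<zeta>(2,1) m] by blast
    have "\<eta>' k \<le> (C * D * E) * \<zeta> k" for k
    proof -
      have "\<eta>' k \<le> C * (D * \<zeta> (k div m))"
        unfolding \<eta>'_def using \<open>1 \<le> C\<close> by (intro mult_left_mono D) simp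
      also have "\<dots> \<le> C * (D * (E * \<zeta> k))"
        using \<open>1 \<le> C\<close> by (intro mult_left_mono D E) simp
      finally show ?thesis by (simp add: mult.assoc)
    qed
    then have "\<exists>C. \<forall>k. \<eta>' k \<le> C * \<zeta> k" by (intro exI allI)
    with not_eta show False by (rule notE)
  qed
  ultimately show ?thesis using \<open>L \<subseteq> J\<close> by blast
qed

lemma Delta_half_PL_lower_dense:
  fixes e :: "nat \<Rightarrow> 'a::chilbert_space"
  assumes e: "orthonormal_basis e" and I: "I \<in> Delta_half_PL e" and J: "J \<in> PL" and "J \<subset> I"
  shows "\<exists>L\<in>Delta_half_PL e. J \<subset> L \<and> L \<subset> I"
proof -
  obtain \<xi> M where I_eq: "I = principal_ideal (diag_op e \<xi>)" and cI: "compact_op (diag_op e \<xi>)"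
    and dI: "Delta_half \<xi>" and "doubling_sequence \<xi> M"
    using Delta_half_PL_E[OF I] .
  then interpret doubling_sequence \<xi> M by blast
  obtain \<eta> where \<eta>: "\<eta> \<in> c0_star" and J_eq: "J = principal_ideal (diag_op e \<eta>)"
    and cJ: "compact_op (diag_op e \<eta>)"
    using PL_E[OF J e] .
  note I_iff = principal_ideal_diag_op_subset_iff_bigo[OF e _ c0 dI cI]
  note J_iff = principal_ideal_diag_op_subset_iff[OF e _ \<eta> cJ]
  obtain C0 where C0: "0 \<le> C0" "\<And>k. \<eta> k \<le> C0 * \<xi> k"
    using \<open>J \<subset> I\<close> unfolding I_eq J_eq psubset_eq I_iff[OF \<eta>] by blast
  define C where "C = max C0 1"
  have C_pos: "0 < C" by (simp add: C_def)
  \<comment> \<open>Since \<open>\<xi>\<close> satisfies the doubling condition,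
    \<open>J \<subseteq> I\<close> bounds \<open>\<eta>\<close> by a multiple of
    \<open>\<xi>\<close> itself; rescaling turns this into pointwise domination.\<close>
  define \<eta>' where "\<eta>' k = \<eta> k / C" for k
  have \<eta>_eq: "\<eta> k = C * \<eta>' k" for k using C_pos by (simp add: \<eta>'_def)
  have "\<eta>' \<in> c0_star"
    using c0_star_ampliation[OF \<eta>, of 1 "inverse C"] C_pos
    by (simp add: \<eta>'_def[abs_def] divide_inverse mult.commute)
  moreover have "\<eta>' k \<le> \<xi> k" for k
  proof -
    have "\<eta> k \<le> C * \<xi> k"
      using order_trans[OF C0(2) mult_right_mono[OF max.cobounded1 less_imp_le[OF pos]]]
      unfolding C_def .
    then show ?thesis using C_pos by (simp add: \<eta>_eq)
  qed
  moreover have "\<nexists>D. \<forall>k. \<xi> k \<le> D * \<eta>' (k div m)" if "0 < m" for m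
  proof
    assume "\<exists>D. \<forall>k. \<xi> k \<le> D * \<eta>' (k div m)"
    then obtain D where "\<And>k. \<xi> k \<le> (D / C) * \<eta> (k div m)" by (auto simp: \<eta>'_def)
    then have "I \<subseteq> J" unfolding I_eq J_eq J_iff[OF c0] using that by blast
    with \<open>J \<subset> I\<close> show False by blast
  qed
  ultimately obtain \<zeta> where \<zeta>: "\<zeta> \<in> c0_star" "Delta_half \<zeta>" and \<zeta>_pos: "\<And>k. 0 < \<zeta> k"
    and ge: "\<And>k. \<eta>' k \<le> \<zeta> k" and le: "\<And>k. \<zeta> k \<le> \<xi> k"
    and not_eta: "\<And>m. m > 0 \<Longrightarrow> \<nexists>C. \<forall>k. \<zeta> k \<le> C * \<eta>' (k div m)"
    and not_xi: "\<nexists>C. \<forall>k. \<xi> k \<le> C * \<zeta> k"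
    using exists_sequence_below[of \<eta>'] by blast
  define L where "L = principal_ideal (diag_op e \<zeta>)"
  have "L \<subseteq> I" unfolding I_eq L_def I_iff[OF \<zeta>(1)] using le by (intro exI[of _ 1]) simp
  then have cL: "compact_op (diag_op e \<zeta>)"
    using compact_op_of_mem_principal_ideal[OF cI] mem_principal_ideal unfolding L_def I_eq by blast
  note L_iff = principal_ideal_diag_op_subset_iff_bigo[OF e _ \<zeta> cL]
  have "L \<in> Delta_half_PL e" unfolding L_def by (intro Delta_half_PL_I e \<zeta> cL \<zeta>_pos)
  moreover have "J \<subseteq> L"
    unfolding J_eq L_def L_iff[OF \<eta>] using ge C_pos by (intro exI[of _ C]) (simp add: \<eta>_eq)
  moreover have "\<not> L \<subseteq> J"
  proof
    assume "L \<subseteq> J"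
    then obtain m D where "0 < m" "\<And>k. \<zeta> k \<le> D * \<eta> (k div m)"
      unfolding L_def J_eq J_iff[OF \<zeta>(1)] by blast
    then have "\<forall>k. \<zeta> k \<le> (D * C) * \<eta>' (k div m)" by (simp only: \<eta>_eq mult.assoc) simp
    then have "\<exists>C. \<forall>k. \<zeta> k \<le> C * \<eta>' (k div m)" by (rule exI)
    with not_eta[OF \<open>0 < m\<close>] show False by (rule notE)
  qed
  moreover have "\<not> I \<subseteq> L" unfolding I_eq L_def L_iff[OF c0] using not_xi by blast
  ultimately show ?thesis using \<open>L \<subseteq> I\<close> by blast
qed

theorem theorem3p9:
  fixes e :: "nat \<Rightarrow> 'a::chilbert_space"
  assumes "separable_hilbert TYPE('a)"
    and "infinite_dimensional TYPE('a)"
    and "orthonormal_basis e"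
  shows "(\<forall>I\<in>Delta_half_PL e. \<forall>J\<in>PL. I \<subset> J \<longrightarrow>
            (\<exists>L\<in>Delta_half_PL e. I \<subset> L \<and> L \<subset> J)) \<and>
         (\<forall>I\<in>Delta_half_PL e. \<forall>J\<in>PL. J \<subset> I \<longrightarrow>
            (\<exists>L\<in>Delta_half_PL e. J \<subset> L \<and> L \<subset> I))"
  by (intro conjI ballI impI Delta_half_PL_upper_dense[OF assms(3)]
      Delta_half_PL_lower_dense[OF assms(3)])

end
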